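(* Let $A$ be an algebraic quantum groupoid. If $A$ has a single faithful (left) cointegral $h\in A$, then the dual $\widehat A$ is of compact type.
   Context: All algebras are over $\mathbb{C}$, associative, possibly non-unital, with non-degenerate product. $A$ is idempotent if $A^2=A$; $M(A)$ is the multiplier algebra (identity $1$); $A'$ is the space of all linear functionals on $A$. A coproduct is a homomorphism $\Delta:A\to M(A\otimes A)$ with $\Delta(a)(1\otimes b),(a\otimes 1)\Delta(b)\in A\otimes A$, coassociative: $(a\otimes1\otimes1)(\Delta\otimes id)(\Delta(b)(1\otimes c))=(id\otimes\Delta)((a\otimes1)\Delta(b))(1\otimes1\otimes c)$. Put $T_1(a\otimes b)=\Delta(a)(1\otimes b)$, $T_2(a\otimes b)=(a\otimes1)\Delta(b)$. $\Delta$ is full if the smallest subspaces $V,W\subset A$ with $\Delta(A)(1\otimes A)\subset V\otimes A$ and $(A\otimes1)\Delta(A)\subset A\otimes W$ both equal $A$. A counit is a linear functional $\varepsilon$ with $(\varepsilon\otimes id)(\Delta(a)(1\otimes b))=ab$, $(id\otimes\varepsilon)((c\otimes1)\Delta(a))=ca$. A weak multiplier Hopf algebra is a non-degenerate idempotent algebra $A$ with a full coproduct $\Delta$ and a counit such that: (i) there is an idempotent $E\in M(A\otimes A)$ with $T_1(A\otimes A)=E(A\otimes A)$, $T_2(A\otimes A)=(A\otimes A)E$; (ii) $(id\otimes\Delta)E=(E\otimes1)(1\otimes E)=(1\otimes E)(E\otimes1)$; (iii) $\mathrm{Ker}(T_i)=(1-G_i)(A\otimes A)$, $i=1,2$, where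 $G_1,G_2$ are the linear maps on $A\otimes A$ given by $(G_1\otimes id)(\Delta_{13}(a)(1\otimes b\otimes c))=\Delta_{13}(a)(1\otimes E)(1\otimes b\otimes c)$ and $(id\otimes G_2)((a\otimes b\otimes1)\Delta_{13}(c))=(a\otimes b\otimes1)(E\otimes1)\Delta_{13}(c)$. Here $\Delta$ (and likewise $id\otimes\Delta$) is uniquely extended to multipliers, with $\Delta(1)=E$. With Sweedler notation $\Delta(a)=\sum a_{(1)}\otimes a_{(2)}$, the antipode $S$ is the non-degenerate anti-homomorphism $A\to M(A)$ with $E(a\otimes b)=\sum a_{(1)}\otimes a_{(2)}S(a_{(3)})b$, $(a\otimes b)E=\sum aS(b_{(1)})b_{(2)}\otimes b_{(3)}$, $G_1(a\otimes b)=\sum a_{(1)}\otimes S(a_{(2)})a_{(3)}b$, $G_2(a\otimes b)=\sum ab_{(1)}S(b_{(2)})\otimes b_{(3)}$, $\sum S(a_{(1)})a_{(2)}S(a_{(3)})=S(a)$; it extends to $M(A)$. $A$ is regular if $S$ is bijective from $A$ to $A$; then also $\Delta(a)(b\otimes1),(1\otimes a)\Delta(b)\in A\otimes A$. Put $\varepsilon_t(a)=\sum a_{(1)}S(a_{(2)})$, $A_t=\{x\in M(A):\Delta(x)=(x\otimes1)E\}$. For $f\in A'$, $(id\otimes f)\Delta(a)$ and $(f\otimes id)\Delta(a)$ are the elements of $M(A)$ defined by slicing after multiplying, on either side, by $b\otimes1$, resp. $1\otimes b$, $b\in A$. A left integral is a non-zero $\varphi\in A'$ with $(id\otimes\varphi)\Delta(a)\in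 A_t$ for all $a\in A$. The set of left integrals is faithful if: $\varphi(xa)=0$ for all left integrals $\varphi$ and $a\in A$ implies $x=0$, and $\varphi(ax)=0$ for all such $\varphi,a$ implies $x=0$. An algebraic quantum groupoid is a regular weak multiplier Hopf algebra with a faithful set of integrals; it is of compact type if its underlying algebra has an identity. Its dual is $\widehat A=\{\varphi(\cdot\,a):a\in A,\ \varphi\text{ a left integral}\}\subset A'$, which is (known result) again an algebraic quantum groupoid with the dual structure: product $(\omega\omega')(a)=(\omega\otimes\omega')\Delta(a)$, coproduct determined by $\langle a\otimes b,\widehat\Delta(\omega)\rangle=\omega(ab)$. A left cointegral is a non-zero $h\in M(A)$ with $ah=\varepsilon_t(a)h$ for all $a\in A$. It is faithful if for $f\in A'$, $(id\otimes f)\Delta(h)=0$ or $(f\otimes id)\Delta(h)=0$ implies $f=0$. ("Single" means that one element $h$ alone is faithful.) *)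

theory Defs
  imports Complex_Main
begin

section \<open>Complex vector spaces and (possibly non-unital) complex algebras\<close>

class complex_vec = ab_group_add +
  fixes scaleC :: "complex \<Rightarrow> 'a \<Rightarrow> 'a"  (infixr "*\<^sub>C" 75)
  assumes scaleC_add_right: "c *\<^sub>C (x + y) = c *\<^sub>C x + c *\<^sub>C y"
    and scaleC_add_left: "(c + d) *\<^sub>C x = c *\<^sub>C x + d *\<^sub>C x"
    and scaleC_scaleC: "c *\<^sub>C d *\<^sub>C x = (c * d) *\<^sub>C x"
    and scaleC_one: "1 *\<^sub>C x = x"

class complex_algebra = complex_vec + ring +
  assumes scaleC_mult_left: "(c *\<^sub>C x) * y = c *\<^sub>C (x * y)"
    and scaleC_mult_right: "x * (c *\<^sub>C y) = c *\<^sub>C (x * y)"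

global_interpretation cvec: vector_space "scaleC :: complex \<Rightarrow> 'a \<Rightarrow> 'a::complex_vec"
  by unfold_locales (simp_all add: scaleC_add_right scaleC_add_left scaleC_scaleC scaleC_one)

instantiation complex :: complex_algebra
begin

definition scaleC_complex :: "complex \<Rightarrow> complex \<Rightarrow> complex"
  where "scaleC_complex c x = c * x"

instance
  by standard (simp_all add: scaleC_complex_def algebra_simps)

end

abbreviation clinear :: "('a::complex_vec \<Rightarrow> 'b::complex_vec) \<Rightarrow> bool"
  where "clinear \<equiv> Vector_Spaces.linear scaleC scaleC"

global_interpretation cvec_pair: vector_space_pair
  "scaleC :: complex \<Rightarrow> 'a \<Rightarrow> 'a::complex_vec" "scaleC :: complex \<Rightarrow> 'b \<Rightarrow> 'b::complex_vec"
  by unfold_locales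

definition cbilinear :: "('a::complex_vec \<Rightarrow> 'b::complex_vec \<Rightarrow> 'c::complex_vec) \<Rightarrow> bool"
  where "cbilinear f \<longleftrightarrow> (\<forall>a. clinear (f a)) \<and> (\<forall>b. clinear (\<lambda>a. f a b))"

lemma clinearI:
  assumes "\<And>x y. f (x + y) = f x + f y" "\<And>c x. f (c *\<^sub>C x) = c *\<^sub>C f x"
  shows "clinear f"
  using assms by unfold_locales

lemma clinear_add: "clinear f \<Longrightarrow> f (x + y) = f x + f y"
  by (rule cvec_pair.linear_add)

lemma clinear_scale: "clinear f \<Longrightarrow> f (c *\<^sub>C x) = c *\<^sub>C f x"
  by (rule cvec_pair.linear_scale)

lemma clinear_0: "clinear f \<Longrightarrow> f 0 = 0"
  by (rule cvec_pair.linear_0)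

lemma clinear_diff: "clinear f \<Longrightarrow> f (x - y) = f x - f y"
  by (rule cvec_pair.linear_diff)

lemma clinear_compose: "clinear f \<Longrightarrow> clinear g \<Longrightarrow> clinear (\<lambda>x. g (f x))"
  by (rule clinearI) (simp_all add: clinear_add clinear_scale)

lemma clinear_id: "clinear (\<lambda>x. x)" "clinear id"
  by (rule clinearI; simp)+

lemma cbilinearI:
  assumes "\<And>a a' b. f (a + a') b = f a b + f a' b" "\<And>a b b'. f a (b + b') = f a b + f a b'"
    "\<And>c a b. f (c *\<^sub>C a) b = c *\<^sub>C f a b" "\<And>c a b. f a (c *\<^sub>C b) = c *\<^sub>C f a b"
  shows "cbilinear f"
  unfolding cbilinear_def using assms by (auto intro: clinearI)

lemma cbilinearD:
  assumes "cbilinear f"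
  shows "f (a + a') b = f a b + f a' b" "f a (b + b') = f a b + f a b'"
    "f (c *\<^sub>C a) b = c *\<^sub>C f a b" "f a (c *\<^sub>C b) = c *\<^sub>C f a b"
proof -
  have l: "clinear (f a)" "clinear (\<lambda>a. f a b)" for a b
    using assms by (auto simp: cbilinear_def)
  show "f (a + a') b = f a b + f a' b" "f a (b + b') = f a b + f a b'"
    "f (c *\<^sub>C a) b = c *\<^sub>C f a b" "f a (c *\<^sub>C b) = c *\<^sub>C f a b"
    using clinear_add[OF l(1)] clinear_add[OF l(2)] clinear_scale[OF l(1)] clinear_scale[OF l(2)]
    by blast+
qed

lemma clinear_separates:
  fixes v :: "'a::complex_vec"
  assumes "\<And>g :: 'a \<Rightarrow> complex. clinear g \<Longrightarrow> g v = 0"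
  shows "v = 0"
proof (rule ccontr)
  assume "v \<noteq> 0"
  then have "cvec.independent {v}"
    by simp
  then obtain g :: "'a \<Rightarrow> complex" where "clinear g" "g v = 1"
    using cvec_pair.linear_independent_extend[of "{v}" "\<lambda>_. 1"] by auto
  with assms show False by fastforce
qed

section \<open>The algebraic tensor product\<close>

text \<open>
  Over a field, the canonical map from \<open>A \<otimes> B\<close> to the dual of the space of bilinear forms on
  \<open>A \<times> B\<close> is injective; \<open>A \<otimes> B\<close> is realised as its image, \<open>a \<otimes> b\<close> being evaluation at \<open>(a, b)\<close>.
  The universal property is \<open>tensor_lift\<close> below.
\<close>

typedef (overloaded) ('a::complex_vec, 'b::complex_vec) tensor (infixr "\<otimes>" 75) =
  "{T :: ('a \<Rightarrow> 'b \<Rightarrow> complex) \<Rightarrow> complex.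
      \<exists>xs. T = (\<lambda>\<beta>. if cbilinear \<beta> then \<Sum>(a, b)\<leftarrow>xs. \<beta> a b else 0)}"
  by blast

setup_lifting type_definition_tensor

lift_definition pure_tensor :: "'a::complex_vec \<Rightarrow> 'b::complex_vec \<Rightarrow> 'a \<otimes> 'b"  (infixr "\<otimes>" 75)
  is "\<lambda>a b \<beta>. if cbilinear \<beta> then \<beta> a b else 0"
proof -
  fix a :: 'a and b :: 'b
  show "\<exists>xs. (\<lambda>\<beta>. if cbilinear \<beta> then \<beta> a b else 0)
    = (\<lambda>\<beta>. if cbilinear \<beta> then \<Sum>(a, b)\<leftarrow>xs. \<beta> a b else (0::complex))"
    by (rule exI[of _ "[(a, b)]"]) (simp add: fun_eq_iff)
qed

lemma scale_sum_list_pair: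
  assumes "clinear f"
  shows "f (\<Sum>(a, b)\<leftarrow>xs. g a b) = (\<Sum>(a, b)\<leftarrow>xs. f (g a b))"
  by (induction xs) (auto simp: clinear_0[OF assms] clinear_add[OF assms])

instantiation tensor :: (complex_vec, complex_vec) complex_vec
begin

lift_definition zero_tensor :: "'a \<otimes> 'b" is "\<lambda>_. 0"
proof -
  show "\<exists>xs. (\<lambda>_. 0) = (\<lambda>\<beta>. if cbilinear \<beta> then \<Sum>(a :: 'a, b :: 'b)\<leftarrow>xs. \<beta> a b else (0::complex))"
    by (rule exI[of _ "[]"]) auto
qed

lift_definition plus_tensor :: "'a \<otimes> 'b \<Rightarrow> 'a \<otimes> 'b \<Rightarrow> 'a \<otimes> 'b" is "\<lambda>s t \<beta>. s \<beta> + t \<beta>"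
proof -
  fix s t :: "('a \<Rightarrow> 'b \<Rightarrow> complex) \<Rightarrow> complex"
  assume "\<exists>xs. s = (\<lambda>\<beta>. if cbilinear \<beta> then \<Sum>(a, b)\<leftarrow>xs. \<beta> a b else 0)"
    and "\<exists>xs. t = (\<lambda>\<beta>. if cbilinear \<beta> then \<Sum>(a, b)\<leftarrow>xs. \<beta> a b else 0)"
  then obtain xs ys where
    "s = (\<lambda>\<beta>. if cbilinear \<beta> then \<Sum>(a, b)\<leftarrow>xs. \<beta> a b else 0)"
    "t = (\<lambda>\<beta>. if cbilinear \<beta> then \<Sum>(a, b)\<leftarrow>ys. \<beta> a b else 0)"
    by blast
  then show "\<exists>xs. (\<lambda>\<beta>. s \<beta> + t \<beta>) = (\<lambda>\<beta>. if cbilinear \<beta> then \<Sum>(a, b)\<leftarrow>xs. \<beta> a b else 0)"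
    by (intro exI[of _ "xs @ ys"]) auto
qed

lift_definition scaleC_tensor :: "complex \<Rightarrow> 'a \<otimes> 'b \<Rightarrow> 'a \<otimes> 'b" is "\<lambda>c t \<beta>. c * t \<beta>"
proof -
  fix c and t :: "('a \<Rightarrow> 'b \<Rightarrow> complex) \<Rightarrow> complex"
  assume "\<exists>xs. t = (\<lambda>\<beta>. if cbilinear \<beta> then \<Sum>(a, b)\<leftarrow>xs. \<beta> a b else 0)"
  then obtain xs where t: "t = (\<lambda>\<beta>. if cbilinear \<beta> then \<Sum>(a, b)\<leftarrow>xs. \<beta> a b else 0)"
    by blast
  have "c * (\<Sum>(a, b)\<leftarrow>xs. \<beta> a b) = (\<Sum>(a, b)\<leftarrow>map (map_prod (scaleC c) id) xs. \<beta> a b)"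
    if "cbilinear \<beta>" for \<beta> :: "'a \<Rightarrow> 'b \<Rightarrow> complex"
  proof (induction xs)
    case (Cons x xs)
    have "\<beta> (c *\<^sub>C fst x) (snd x) = c * \<beta> (fst x) (snd x)"
      using that clinear_scale[of "\<lambda>a. \<beta> a (snd x)" c "fst x"]
      by (simp add: cbilinear_def scaleC_complex_def)
    with Cons show ?case
      by (simp add: algebra_simps case_prod_unfold)
  qed simp
  then show "\<exists>xs. (\<lambda>\<beta>. c * t \<beta>) = (\<lambda>\<beta>. if cbilinear \<beta> then \<Sum>(a, b)\<leftarrow>xs. \<beta> a b else 0)"
    unfolding t by (intro exI[of _ "map (map_prod (scaleC c) id) xs"]) fastforce
qed

definition uminus_tensor :: "'a \<otimes> 'b \<Rightarrow> 'a \<otimes> 'b" where "uminus_tensor t = (-1) *\<^sub>C t"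

definition minus_tensor :: "'a \<otimes> 'b \<Rightarrow> 'a \<otimes> 'b \<Rightarrow> 'a \<otimes> 'b" where "minus_tensor s t = s + - t"

instance
  by standard
    (unfold uminus_tensor_def minus_tensor_def, (transfer, simp add: algebra_simps)+)

end

lemma pure_tensor_simps:
  "(a + a') \<otimes> b = a \<otimes> b + a' \<otimes> b" "a \<otimes> (b + b') = a \<otimes> b + a \<otimes> b'"
  "(c *\<^sub>C a) \<otimes> b = c *\<^sub>C (a \<otimes> b)" "a \<otimes> (c *\<^sub>C b) = c *\<^sub>C (a \<otimes> b)"
  by (transfer, auto simp: cbilinearD scaleC_complex_def fun_eq_iff)+

lemma cbilinear_pure_tensor: "cbilinear (\<otimes>)"
  by (rule cbilinearI) (rule pure_tensor_simps)+

lemma Rep_tensor_sum_list: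
  "Rep_tensor (\<Sum>(a, b)\<leftarrow>xs. a \<otimes> b) = (\<lambda>\<beta>. if cbilinear \<beta> then \<Sum>(a, b)\<leftarrow>xs. \<beta> a b else 0)"
  by (induction xs) (auto simp: zero_tensor.rep_eq plus_tensor.rep_eq pure_tensor.rep_eq fun_eq_iff)

lemma tensor_cases: obtains xs where "t = (\<Sum>(a, b)\<leftarrow>xs. a \<otimes> b)"
proof -
  from Rep_tensor[of t] obtain xs
    where "Rep_tensor t = (\<lambda>\<beta>. if cbilinear \<beta> then \<Sum>(a, b)\<leftarrow>xs. \<beta> a b else 0)"
    by blast
  then show ?thesis
    using that[of xs] Rep_tensor_sum_list[of xs] by (simp add: Rep_tensor_inject[symmetric])
qed

lemma tensor_induct [case_names zero pure add]:
  assumes "P 0" "\<And>a b. P (a \<otimes> b)" "\<And>s t. P s \<Longrightarrow> P t \<Longrightarrow> P (s + t)"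
  shows "P t"
proof -
  obtain xs where "t = (\<Sum>(a, b)\<leftarrow>xs. a \<otimes> b)"
    by (rule tensor_cases)
  moreover have "P (\<Sum>(a, b)\<leftarrow>xs. a \<otimes> b)"
    by (induction xs) (auto simp: assms)
  ultimately show ?thesis by simp
qed

lemma clinear_tensor_ext:
  assumes "clinear f" "clinear g" "\<And>a b. f (a \<otimes> b) = g (a \<otimes> b)"
  shows "f = g"
proof
  show "f t = g t" for t
    by (induction t rule: tensor_induct)
      (simp_all add: assms(3) clinear_0[OF assms(1)] clinear_0[OF assms(2)]
        clinear_add[OF assms(1)] clinear_add[OF assms(2)])
qed

definition tensor_lift ::
    "('a::complex_vec \<Rightarrow> 'b::complex_vec \<Rightarrow> 'c::complex_vec) \<Rightarrow> 'a \<otimes> 'b \<Rightarrow> 'c"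
  where "tensor_lift f = (THE L. clinear L \<and> (\<forall>a b. L (a \<otimes> b) = f a b))"

lemma tensor_lift_exists:
  fixes f :: "'a::complex_vec \<Rightarrow> 'b::complex_vec \<Rightarrow> 'c::complex_vec"
  assumes f: "cbilinear f"
  shows "\<exists>!L. clinear L \<and> (\<forall>a b. L (a \<otimes> b) = f a b)"
proof -
  have wd: "(\<Sum>(a, b)\<leftarrow>xs. f a b) = (\<Sum>(a, b)\<leftarrow>ys. f a b)"
    if eq: "(\<Sum>(a, b)\<leftarrow>xs. a \<otimes> b) = (\<Sum>(a, b)\<leftarrow>ys. a \<otimes> b)" for xs ys
  proof -
    have "(\<Sum>(a, b)\<leftarrow>xs. f a b) - (\<Sum>(a, b)\<leftarrow>ys. f a b) = 0"
    proof (rule clinear_separates)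
      fix g :: "'c \<Rightarrow> complex"
      assume g: "clinear g"
      have "cbilinear (\<lambda>a b. g (f a b))"
        using f g by (auto simp: cbilinear_def intro: clinear_compose)
      moreover have "Rep_tensor (\<Sum>(a, b)\<leftarrow>xs. a \<otimes> b) (\<lambda>a b. g (f a b))
          = Rep_tensor (\<Sum>(a, b)\<leftarrow>ys. a \<otimes> b) (\<lambda>a b. g (f a b))"
        by (simp only: eq)
      ultimately have "(\<Sum>(a, b)\<leftarrow>xs. g (f a b)) = (\<Sum>(a, b)\<leftarrow>ys. g (f a b))"
        by (simp add: Rep_tensor_sum_list)
      then show "g ((\<Sum>(a, b)\<leftarrow>xs. f a b) - (\<Sum>(a, b)\<leftarrow>ys. f a b)) = 0"
        by (simp add: clinear_diff[OF g] scale_sum_list_pair[OF g])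
    qed
    then show ?thesis by simp
  qed
  define rep :: "'a \<otimes> 'b \<Rightarrow> ('a \<times> 'b) list"
    where "rep t = (SOME xs. t = (\<Sum>(a, b)\<leftarrow>xs. a \<otimes> b))" for t
  define L where "L t = (\<Sum>(a, b)\<leftarrow>rep t. f a b)" for t
  have rep: "t = (\<Sum>(a, b)\<leftarrow>rep t. a \<otimes> b)" for t
    unfolding rep_def by (rule someI_ex) (metis tensor_cases)
  have L: "L t = (\<Sum>(a, b)\<leftarrow>xs. f a b)" if "t = (\<Sum>(a, b)\<leftarrow>xs. a \<otimes> b)" for t xs
    unfolding L_def using rep[of t] that by (intro wd) simp
  have pure: "L (a \<otimes> b) = f a b" for a b
    by (subst L[of _ "[(a, b)]"]) simp_all
  have add: "L (s + t) = L s + L t" for s t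
    by (subst L[of "s + t" "rep s @ rep t"]) (simp_all add: rep[symmetric] L_def)
  have "L (c *\<^sub>C t) = c *\<^sub>C L t" for c t
  proof (induction t rule: tensor_induct)
    case zero
    have "L 0 = 0" using L[of 0 "[]"] by simp
    then show ?case by simp
  next
    case (pure a b)
    show ?case
      unfolding pure_tensor_simps(3)[symmetric] \<open>\<And>a b. L (a \<otimes> b) = f a b\<close>
      by (rule cbilinearD(3)[OF f])
  next
    case (add s t)
    then show ?case by (simp add: \<open>\<And>s t. L (s + t) = L s + L t\<close> scaleC_add_right)
  qed
  with add have "clinear L" by (rule clinearI)
  with pure show ?thesis
    by (intro ex1I[of _ L]) (auto intro: clinear_tensor_ext)
qed

lemma
  assumes "cbilinear f"
  shows clinear_tensor_lift: "clinear (tensor_lift f)"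
    and tensor_lift_pure: "tensor_lift f (a \<otimes> b) = f a b"
  using theI'[OF tensor_lift_exists[OF assms]] by (simp_all add: tensor_lift_def)

definition tensor_map ::
    "('a::complex_vec \<Rightarrow> 'c::complex_vec) \<Rightarrow> ('b::complex_vec \<Rightarrow> 'd::complex_vec) \<Rightarrow> 'a \<otimes> 'b \<Rightarrow> 'c \<otimes> 'd"
  where "tensor_map f g = tensor_lift (\<lambda>a b. f a \<otimes> g b)"

lemma
  assumes "clinear f" "clinear g"
  shows clinear_tensor_map: "clinear (tensor_map f g)"
    and tensor_map_pure: "tensor_map f g (a \<otimes> b) = f a \<otimes> g b"
proof -
  have "cbilinear (\<lambda>a b. f a \<otimes> g b)"
    using assms by (intro cbilinearI) (simp_all add: clinear_add clinear_scale pure_tensor_simps)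
  then show "clinear (tensor_map f g)" "tensor_map f g (a \<otimes> b) = f a \<otimes> g b"
    by (simp_all add: tensor_map_def clinear_tensor_lift tensor_lift_pure)
qed

instantiation tensor :: (complex_algebra, complex_algebra) complex_algebra
begin

definition times_tensor :: "'a \<otimes> 'b \<Rightarrow> 'a \<otimes> 'b \<Rightarrow> 'a \<otimes> 'b"
  where "s * t = tensor_lift (\<lambda>a b. tensor_lift (\<lambda>a' b'. (a * a') \<otimes> (b * b')) t) s"

instance
proof
  have 1: "cbilinear (\<lambda>a' b'. (a * a') \<otimes> (b * b'))" for a :: 'a and b :: 'b
    by (rule cbilinearI)
      (simp_all add: pure_tensor_simps distrib_left scaleC_mult_right)
  note lift1 = clinear_tensor_lift[OF 1] tensor_lift_pure[OF 1]
  have 2: "cbilinear (\<lambda>a b. tensor_lift (\<lambda>a' b'. (a * a') \<otimes> (b * b')) t)" for t :: "'a \<otimes> 'b"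
  proof (induction t rule: tensor_induct)
    case zero
    show ?case by (rule cbilinearI) (simp_all add: clinear_0[OF lift1(1)])
  next
    case (pure x y)
    show ?case
      unfolding lift1(2)
      by (rule cbilinearI)
        (simp_all add: pure_tensor_simps distrib_right scaleC_mult_left)
  next
    case (add s t)
    show ?case
      unfolding clinear_add[OF lift1(1)]
      using add
      by (auto simp: cbilinear_def intro!: cvec_pair.linear_compose_add)
  qed
  have l: "clinear (\<lambda>s. s * t)" for t :: "'a \<otimes> 'b"
    unfolding times_tensor_def by (rule clinear_tensor_lift[OF 2])
  have pure: "(a \<otimes> b) * t = tensor_lift (\<lambda>a' b'. (a * a') \<otimes> (b * b')) t"
    for a :: 'a and b :: 'b and t
    unfolding times_tensor_def by (rule tensor_lift_pure[OF 2])
  have pp: "(a \<otimes> b) * (a' \<otimes> b') = (a * a') \<otimes> (b * b')" for a a' :: 'a and b b' :: 'b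
    by (simp add: pure lift1(2))
  have r: "s * (t + t') = s * t + s * t'" "s * (c *\<^sub>C t) = c *\<^sub>C (s * t)"
    for s t t' :: "'a \<otimes> 'b" and c
  proof (induction s rule: tensor_induct)
    case zero
    show "0 * (t + t') = 0 * t + 0 * t'" "0 * (c *\<^sub>C t) = c *\<^sub>C (0 * t)"
      using clinear_0[OF l] by simp_all
  next
    case (pure a b)
    show "(a \<otimes> b) * (t + t') = (a \<otimes> b) * t + (a \<otimes> b) * t'"
      "(a \<otimes> b) * (c *\<^sub>C t) = c *\<^sub>C ((a \<otimes> b) * t)"
      by (simp_all add: \<open>\<And>a b t. (a \<otimes> b) * t = _ a b t\<close> clinear_add[OF lift1(1)]
          clinear_scale[OF lift1(1)])
  next
    case (add u v)
    then show "(u + v) * (t + t') = (u + v) * t + (u + v) * t'"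
      "(u + v) * (c *\<^sub>C t) = c *\<^sub>C ((u + v) * t)"
      by (simp_all add: clinear_add[OF l] scaleC_add_right algebra_simps)
  qed
  have z: "t * 0 = 0" "0 * t = 0" for t :: "'a \<otimes> 'b"
    using r(2)[of t 0 0] clinear_0[OF l] by simp_all
  fix s t u :: "'a \<otimes> 'b" and c
  show "(s + t) * u = s * u + t * u" "(c *\<^sub>C s) * t = c *\<^sub>C (s * t)"
    by (rule clinear_add[OF l], rule clinear_scale[OF l])
  show "s * (t + u) = s * t + s * u" "s * (c *\<^sub>C t) = c *\<^sub>C (s * t)"
    by (rule r)+
  show "s * t * u = s * (t * u)"
  proof (induction s rule: tensor_induct)
    case (pure a b)
    show ?case
    proof (induction t rule: tensor_induct)
      case (pure a' b')
      show ?case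
        by (induction u rule: tensor_induct) (simp_all add: z pp mult.assoc r)
    qed (simp_all add: z r clinear_add[OF l])
  qed (simp_all add: z clinear_add[OF l])
qed

end

lemma tensor_mult_pure: "(a \<otimes> b) * (a' \<otimes> b') = (a * a') \<otimes> (b * b')"
proof -
  have 1: "cbilinear (\<lambda>a' b'. (a * a') \<otimes> (b * b'))" for a :: 'a and b :: 'b
    by (rule cbilinearI) (simp_all add: pure_tensor_simps distrib_left scaleC_mult_right)
  have 2: "cbilinear (\<lambda>a b. (a * a') \<otimes> (b * b'))"
    by (rule cbilinearI) (simp_all add: pure_tensor_simps distrib_right scaleC_mult_left)
  show ?thesis
    by (simp add: times_tensor_def tensor_lift_pure[OF 1] tensor_lift_pure[OF 2])
qed

section \<open>Multiplier algebras\<close>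

text \<open>
  A multiplier \<open>m\<close> is the pair of maps \<open>(a \<mapsto> m a, a \<mapsto> a m)\<close>. For non-degenerate algebras the last
  condition implies the others.
\<close>

typedef (overloaded) 'a::complex_algebra multiplier =
  "{(l :: 'a \<Rightarrow> 'a, r :: 'a \<Rightarrow> 'a). clinear l \<and> clinear r
      \<and> (\<forall>a b. l (a * b) = l a * b) \<and> (\<forall>a b. r (a * b) = a * r b) \<and> (\<forall>a b. r a * b = a * l b)}"
  by (rule exI[of _ "(\<lambda>a. a, \<lambda>a. a)"]) (simp add: clinear_id)

setup_lifting type_definition_multiplier

lift_definition lact :: "'a::complex_algebra multiplier \<Rightarrow> 'a \<Rightarrow> 'a"  (infixr "\<rhd>" 73) is fst .

lift_definition ract :: "'a::complex_algebra \<Rightarrow> 'a multiplier \<Rightarrow> 'a"  (infixl "\<lhd>" 73)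
  is "\<lambda>a m. snd m a" .

lemma multiplier_eqI: "(\<And>a. m \<rhd> a = n \<rhd> a) \<Longrightarrow> (\<And>a. a \<lhd> m = a \<lhd> n) \<Longrightarrow> m = n"
  by transfer (auto simp: fun_eq_iff)

lemma clinear_lact: "clinear (lact m)" and clinear_ract: "clinear (\<lambda>a. a \<lhd> m)"
  by (transfer, auto)+

lemmas act_linear =
  clinear_add[OF clinear_lact] clinear_add[OF clinear_ract]
  clinear_scale[OF clinear_lact] clinear_scale[OF clinear_ract]

instantiation multiplier :: (complex_algebra) "{complex_algebra, monoid_mult}"
begin

lift_definition zero_multiplier :: "'a multiplier" is "(\<lambda>_. 0, \<lambda>_. 0)"
  by (auto intro: clinearI)

lift_definition one_multiplier :: "'a multiplier" is "(\<lambda>a. a, \<lambda>a. a)"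
  by (auto intro: clinearI)

lift_definition plus_multiplier :: "'a multiplier \<Rightarrow> 'a multiplier \<Rightarrow> 'a multiplier"
  is "\<lambda>m n. (\<lambda>a. fst m a + fst n a, \<lambda>a. snd m a + snd n a)"
  by (auto intro!: clinearI simp: clinear_add clinear_scale scaleC_add_right algebra_simps)

lift_definition scaleC_multiplier :: "complex \<Rightarrow> 'a multiplier \<Rightarrow> 'a multiplier"
  is "\<lambda>c m. (\<lambda>a. c *\<^sub>C fst m a, \<lambda>a. c *\<^sub>C snd m a)"
  by (auto intro!: clinearI simp: clinear_add clinear_scale scaleC_add_right
      scaleC_scaleC mult.commute scaleC_mult_left scaleC_mult_right)

lift_definition times_multiplier :: "'a multiplier \<Rightarrow> 'a multiplier \<Rightarrow> 'a multiplier"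
  is "\<lambda>m n. (\<lambda>a. fst m (fst n a), \<lambda>a. snd n (snd m a))"
  by (auto intro!: clinearI simp: clinear_add clinear_scale)

definition uminus_multiplier :: "'a multiplier \<Rightarrow> 'a multiplier"
  where "uminus_multiplier m = (-1) *\<^sub>C m"

definition minus_multiplier :: "'a multiplier \<Rightarrow> 'a multiplier \<Rightarrow> 'a multiplier"
  where "minus_multiplier m n = m + - n"

instance
  by standard
    (unfold uminus_multiplier_def minus_multiplier_def,
      (transfer, auto simp: fun_eq_iff algebra_simps clinear_add clinear_scale
        scaleC_add_right scaleC_add_left scaleC_scaleC scaleC_one)+)

end

lift_definition embed :: "'a::complex_algebra \<Rightarrow> 'a multiplier" is "\<lambda>a. (\<lambda>b. a * b, \<lambda>b. b * a)"
  by (auto intro!: clinearI simp: distrib_left distrib_right scaleC_mult_left scaleC_mult_right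
      mult.assoc)

lemma act_simps [simp]:
  "embed a \<rhd> b = a * b" "b \<lhd> embed a = b * a"
  "(m * n) \<rhd> b = m \<rhd> n \<rhd> b" "b \<lhd> (m * n) = b \<lhd> m \<lhd> n"
  "1 \<rhd> b = b" "b \<lhd> 1 = b"
  by (transfer, simp)+

text \<open>The element of the algebra that a multiplier in the range of \<^const>\<open>embed\<close> comes from.\<close>

definition unembed :: "'a::complex_algebra multiplier \<Rightarrow> 'a"
  where "unembed m = (THE a. embed a = m)"

text \<open>
  The tensor product \<open>m \<otimes> n \<in> M(A \<otimes> B)\<close> of multipliers, and the transport of a multiplier along an
  isomorphism of algebras.
\<close>

definition mtensor ::
    "'a::complex_algebra multiplier \<Rightarrow> 'b::complex_algebra multiplier \<Rightarrow> ('a \<otimes> 'b) multiplier"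
    (infixr "\<otimes>\<^sub>M" 75)
  where "m \<otimes>\<^sub>M n =
    Abs_multiplier (tensor_map (lact m) (lact n), tensor_map (\<lambda>a. a \<lhd> m) (\<lambda>b. b \<lhd> n))"

lemma mtensor_act:
  "(m \<otimes>\<^sub>M n) \<rhd> t = tensor_map (lact m) (lact n) t"
  "t \<lhd> (m \<otimes>\<^sub>M n) = tensor_map (\<lambda>a. a \<lhd> m) (\<lambda>b. b \<lhd> n) t"
proof -
  let ?l = "tensor_map (lact m) (lact n)" and ?r = "tensor_map (\<lambda>a. a \<lhd> m) (\<lambda>b. b \<lhd> n)"
  note l = clinear_tensor_map[OF clinear_lact clinear_lact, of m n]
    tensor_map_pure[OF clinear_lact clinear_lact, of m n]
  note r = clinear_tensor_map[OF clinear_ract clinear_ract, of m n]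
    tensor_map_pure[OF clinear_ract clinear_ract, of m n]
  have ml: "m \<rhd> (a * b) = (m \<rhd> a) * b" and mr: "(a * b) \<lhd> m = a * (b \<lhd> m)"
    and mm: "(a \<lhd> m) * b = a * (m \<rhd> b)" for m :: "'c::complex_algebra multiplier" and a b
    by (transfer, auto)+
  have "?l (s * t) = ?l s * t" for s t
    by (induction s rule: tensor_induct; induction t rule: tensor_induct)
      (simp_all add: clinear_0[OF l(1)] clinear_add[OF l(1)] l(2) tensor_mult_pure ml algebra_simps)
  moreover have "?r (s * t) = s * ?r t" for s t
    by (induction s rule: tensor_induct; induction t rule: tensor_induct)
      (simp_all add: clinear_0[OF r(1)] clinear_add[OF r(1)] r(2) tensor_mult_pure mr algebra_simps)
  moreover have "?r s * t = s * ?l t" for s t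
    by (induction s rule: tensor_induct; induction t rule: tensor_induct)
      (simp_all add: clinear_0[OF l(1)] clinear_add[OF l(1)] l(2)
        clinear_0[OF r(1)] clinear_add[OF r(1)] r(2) tensor_mult_pure mm algebra_simps)
  ultimately have "Rep_multiplier (m \<otimes>\<^sub>M n) = (?l, ?r)"
    unfolding mtensor_def using l(1) r(1) by (intro Abs_multiplier_inverse) blast
  then show "(m \<otimes>\<^sub>M n) \<rhd> t = ?l t" "t \<lhd> (m \<otimes>\<^sub>M n) = ?r t"
    by (simp_all only: lact.rep_eq[of "m \<otimes>\<^sub>M n"] ract.rep_eq[of t "m \<otimes>\<^sub>M n"] fst_conv snd_conv)
qed

lemma mtensor_act_pure [simp]:
  "(m \<otimes>\<^sub>M n) \<rhd> (a \<otimes> b) = (m \<rhd> a) \<otimes> (n \<rhd> b)"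
  "(a \<otimes> b) \<lhd> (m \<otimes>\<^sub>M n) = (a \<lhd> m) \<otimes> (b \<lhd> n)"
  by (simp_all add: mtensor_act tensor_map_pure clinear_lact clinear_ract)

definition mtransport ::
    "('a::complex_algebra \<Rightarrow> 'b::complex_algebra) \<Rightarrow> 'a multiplier \<Rightarrow> 'b multiplier"
  where "mtransport \<sigma> m = Abs_multiplier (\<lambda>b. \<sigma> (m \<rhd> inv \<sigma> b), \<lambda>b. \<sigma> (inv \<sigma> b \<lhd> m))"

text \<open>
  The unique extension to \<open>M(B)\<close> of a homomorphism \<open>\<gamma> : B \<rightarrow> M(C)\<close> with \<open>\<gamma>(B)C = eC\<close> and
  \<open>C\<gamma>(B) = Ce\<close> for an idempotent \<open>e \<in> M(C)\<close>, normalised by \<open>1 \<mapsto> e\<close>.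
\<close>

definition extend_hom ::
    "('b::complex_algebra \<Rightarrow> 'c::complex_algebra multiplier) \<Rightarrow> 'c multiplier \<Rightarrow>
      'b multiplier \<Rightarrow> 'c multiplier"
  where "extend_hom \<gamma> e = (THE \<Gamma>. clinear \<Gamma> \<and> (\<forall>m n. \<Gamma> (m * n) = \<Gamma> m * \<Gamma> n)
    \<and> (\<forall>b. \<Gamma> (embed b) = \<gamma> b) \<and> \<Gamma> 1 = e)"

section \<open>Leg numbering\<close>

text \<open>Triple tensor products associate to the right.\<close>

definition tassoc :: "('a \<otimes> 'b) \<otimes> 'c \<Rightarrow> 'a::complex_vec \<otimes> 'b::complex_vec \<otimes> 'c::complex_vec"
  where "tassoc = tensor_lift (\<lambda>u c. tensor_lift (\<lambda>a b. a \<otimes> b \<otimes> c) u)"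

definition tperm :: "('a \<otimes> 'c) \<otimes> 'b \<Rightarrow> 'a::complex_vec \<otimes> 'b::complex_vec \<otimes> 'c::complex_vec"
  where "tperm = tensor_lift (\<lambda>u b. tensor_lift (\<lambda>a c. a \<otimes> b \<otimes> c) u)"

definition leg12 :: "('a \<otimes> 'a) multiplier \<Rightarrow> ('a::complex_algebra \<otimes> 'a \<otimes> 'a) multiplier"
  where "leg12 m = mtransport tassoc (m \<otimes>\<^sub>M 1)"

definition leg23 :: "('a \<otimes> 'a) multiplier \<Rightarrow> ('a::complex_algebra \<otimes> 'a \<otimes> 'a) multiplier"
  where "leg23 m = 1 \<otimes>\<^sub>M m"

definition leg13 :: "('a \<otimes> 'a) multiplier \<Rightarrow> ('a::complex_algebra \<otimes> 'a \<otimes> 'a) multiplier"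
  where "leg13 m = mtransport tperm (m \<otimes>\<^sub>M 1)"

text \<open>\<open>(f \<otimes> id)\<close> and \<open>(id \<otimes> f)\<close> on \<open>A \<otimes> A\<close>, for a functional \<open>f\<close>.\<close>

definition slice_fst :: "('a::complex_vec \<Rightarrow> complex) \<Rightarrow> 'a \<otimes> 'a \<Rightarrow> 'a"
  where "slice_fst f = tensor_lift (\<lambda>a b. f a *\<^sub>C b)"

definition slice_snd :: "('a::complex_vec \<Rightarrow> complex) \<Rightarrow> 'a \<otimes> 'a \<Rightarrow> 'a"
  where "slice_snd f = tensor_lift (\<lambda>a b. f b *\<^sub>C a)"

text \<open>
  \<open>(f \<otimes> id)x\<close> and \<open>(id \<otimes> f)x\<close> in \<open>M(A)\<close>, for \<open>x \<in> M(A \<otimes> A)\<close> such that \<open>x(1 \<otimes> b)\<close>, \<open>(1 \<otimes> b)x\<close>,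
  resp. \<open>x(b \<otimes> 1)\<close>, \<open>(b \<otimes> 1)x\<close>, lie in \<open>A \<otimes> A\<close>.
\<close>

definition mslice_fst ::
    "('a \<Rightarrow> complex) \<Rightarrow> ('a::complex_algebra \<otimes> 'a) multiplier \<Rightarrow> 'a multiplier"
  where "mslice_fst f x = (THE m. \<forall>b.
      m \<rhd> b = slice_fst f (unembed (x * (1 \<otimes>\<^sub>M embed b))) \<and>
      b \<lhd> m = slice_fst f (unembed ((1 \<otimes>\<^sub>M embed b) * x)))"

definition mslice_snd ::
    "('a \<Rightarrow> complex) \<Rightarrow> ('a::complex_algebra \<otimes> 'a) multiplier \<Rightarrow> 'a multiplier"
  where "mslice_snd f x = (THE m. \<forall>b.
      m \<rhd> b = slice_snd f (unembed (x * (embed b \<otimes>\<^sub>M 1))) \<and>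
      b \<lhd> m = slice_snd f (unembed ((embed b \<otimes>\<^sub>M 1) * x)))"

section \<open>Weak multiplier Hopf algebras\<close>

definition nondegenerate_idempotent_algebra :: "'a::complex_algebra itself \<Rightarrow> bool"
  where "nondegenerate_idempotent_algebra _ \<longleftrightarrow>
    (\<forall>a :: 'a. (\<forall>b. a * b = 0) \<longrightarrow> a = 0) \<and> (\<forall>a :: 'a. (\<forall>b. b * a = 0) \<longrightarrow> a = 0)
    \<and> cvec.span {a * b | a b :: 'a. True} = UNIV"

definition T1 :: "('a \<Rightarrow> ('a \<otimes> 'a) multiplier) \<Rightarrow> 'a::complex_algebra \<otimes> 'a \<Rightarrow> 'a \<otimes> 'a"
  where "T1 \<Delta> = tensor_lift (\<lambda>a b. unembed (\<Delta> a * (1 \<otimes>\<^sub>M embed b)))"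

definition T2 :: "('a \<Rightarrow> ('a \<otimes> 'a) multiplier) \<Rightarrow> 'a::complex_algebra \<otimes> 'a \<Rightarrow> 'a \<otimes> 'a"
  where "T2 \<Delta> = tensor_lift (\<lambda>a b. unembed ((embed a \<otimes>\<^sub>M 1) * \<Delta> b))"

text \<open>\<open>\<Delta> \<otimes> id\<close> and \<open>id \<otimes> \<Delta>\<close> on \<open>A \<otimes> A\<close>.\<close>

definition coproduct_id ::
    "('a \<Rightarrow> ('a \<otimes> 'a) multiplier) \<Rightarrow> 'a::complex_algebra \<otimes> 'a \<Rightarrow> ('a \<otimes> 'a \<otimes> 'a) multiplier"
  where "coproduct_id \<Delta> = tensor_lift (\<lambda>a b. mtransport tassoc (\<Delta> a \<otimes>\<^sub>M embed b))"

definition id_coproduct ::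
    "('a \<Rightarrow> ('a \<otimes> 'a) multiplier) \<Rightarrow> 'a::complex_algebra \<otimes> 'a \<Rightarrow> ('a \<otimes> 'a \<otimes> 'a) multiplier"
  where "id_coproduct \<Delta> = tensor_lift (\<lambda>a b. embed a \<otimes>\<^sub>M \<Delta> b)"

locale coproduct =
  fixes \<Delta> :: "'a::complex_algebra \<Rightarrow> ('a \<otimes> 'a) multiplier"
  assumes coproduct_linear: "clinear \<Delta>"
    and coproduct_mult: "\<Delta> (a * b) = \<Delta> a * \<Delta> b"
    and coproduct_cover:
      "\<Delta> a * (1 \<otimes>\<^sub>M embed b) \<in> range embed" "(embed a \<otimes>\<^sub>M 1) * \<Delta> b \<in> range embed"
    and coassociative:
      "(embed a \<otimes>\<^sub>M 1) * coproduct_id \<Delta> (T1 \<Delta> (b \<otimes> c))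
        = id_coproduct \<Delta> (T2 \<Delta> (a \<otimes> b)) * (1 \<otimes>\<^sub>M 1 \<otimes>\<^sub>M embed c)"

definition full_coproduct :: "('a::complex_algebra \<Rightarrow> ('a \<otimes> 'a) multiplier) \<Rightarrow> bool"
  where "full_coproduct \<Delta> \<longleftrightarrow>
    (\<forall>V. cvec.subspace V \<and> (\<forall>a b. T1 \<Delta> (a \<otimes> b) \<in> cvec.span {v \<otimes> c | v c. v \<in> V}) \<longrightarrow> V = UNIV) \<and>
    (\<forall>W. cvec.subspace W \<and> (\<forall>a b. T2 \<Delta> (a \<otimes> b) \<in> cvec.span {c \<otimes> w | c w. w \<in> W}) \<longrightarrow> W = UNIV)"

definition counit :: "('a \<Rightarrow> ('a \<otimes> 'a) multiplier) \<Rightarrow> ('a::complex_algebra \<Rightarrow> complex) \<Rightarrow> bool"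
  where "counit \<Delta> \<epsilon> \<longleftrightarrow> clinear \<epsilon> \<and>
    (\<forall>a b. slice_fst \<epsilon> (T1 \<Delta> (a \<otimes> b)) = a * b) \<and> (\<forall>a c. slice_snd \<epsilon> (T2 \<Delta> (c \<otimes> a)) = c * a)"

locale weak_multiplier_hopf_algebra = coproduct \<Delta>
  for \<Delta> :: "'a::complex_algebra \<Rightarrow> ('a \<otimes> 'a) multiplier" +
  fixes \<epsilon> :: "'a \<Rightarrow> complex"
    and E :: "('a \<otimes> 'a) multiplier"
    and G1 G2 :: "'a \<otimes> 'a \<Rightarrow> 'a \<otimes> 'a"
  assumes nondegenerate_idempotent: "nondegenerate_idempotent_algebra TYPE('a)"
    and full: "full_coproduct \<Delta>"
    and counit: "counit \<Delta> \<epsilon>"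
    and E_idempotent: "E * E = E"
    and range_T1: "range (T1 \<Delta>) = range (\<lambda>x. E \<rhd> x)"
    and range_T2: "range (T2 \<Delta>) = range (\<lambda>x. x \<lhd> E)"
    and id_coproduct_E: "extend_hom (id_coproduct \<Delta>) (leg23 E) E = leg12 E * leg23 E"
    and E_legs_commute: "leg12 E * leg23 E = leg23 E * leg12 E"
    and G1_linear: "clinear G1"
    and G1: "embed (tassoc (tensor_map G1 id
          (inv tassoc (unembed (leg13 (\<Delta> a) * (1 \<otimes>\<^sub>M embed b \<otimes>\<^sub>M embed c))))))
        = leg13 (\<Delta> a) * leg23 E * (1 \<otimes>\<^sub>M embed b \<otimes>\<^sub>M embed c)"
    and G2_linear: "clinear G2"
    and G2: "embed (tensor_map id G2 (unembed ((embed a \<otimes>\<^sub>M embed b \<otimes>\<^sub>M 1) * leg13 (\<Delta> c))))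
        = (embed a \<otimes>\<^sub>M embed b \<otimes>\<^sub>M 1) * leg12 E * leg13 (\<Delta> c)"
    and ker_T1: "{x. T1 \<Delta> x = 0} = range (\<lambda>x. x - G1 x)"
    and ker_T2: "{x. T2 \<Delta> x = 0} = range (\<lambda>x. x - G2 x)"

text \<open>
  The Sweedler formulas for the antipode are read through the maps
  \<open>R\<^sub>1(a \<otimes> b) = \<Sum> a\<^sub>(\<^sub>1\<^sub>) \<otimes> S(a\<^sub>(\<^sub>2\<^sub>))b\<close> and \<open>R\<^sub>2(a \<otimes> b) = \<Sum> aS(b\<^sub>(\<^sub>1\<^sub>)) \<otimes> b\<^sub>(\<^sub>2\<^sub>)\<close> from \<open>A \<otimes> A\<close> to itself, which
  are determined by covering the uncovered leg. For instance
  \<open>T\<^sub>1(R\<^sub>1(a \<otimes> b)) = \<Sum> a\<^sub>(\<^sub>1\<^sub>) \<otimes> a\<^sub>(\<^sub>2\<^sub>)S(a\<^sub>(\<^sub>3\<^sub>))b\<close> and \<open>R\<^sub>1(T\<^sub>1(a \<otimes> b)) = \<Sum> a\<^sub>(\<^sub>1\<^sub>) \<otimes> S(a\<^sub>(\<^sub>2\<^sub>))a\<^sub>(\<^sub>3\<^sub>)b\<close>.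
  The last clause is \<open>\<Sum> S(a\<^sub>(\<^sub>1\<^sub>))a\<^sub>(\<^sub>2\<^sub>)S(a\<^sub>(\<^sub>3\<^sub>))b = S(a)b\<close>.
\<close>

definition antipode ::
    "('a \<Rightarrow> ('a \<otimes> 'a) multiplier) \<Rightarrow> ('a \<otimes> 'a) multiplier \<Rightarrow>
      ('a \<otimes> 'a \<Rightarrow> 'a \<otimes> 'a) \<Rightarrow> ('a \<otimes> 'a \<Rightarrow> 'a \<otimes> 'a) \<Rightarrow> ('a::complex_algebra \<Rightarrow> 'a multiplier) \<Rightarrow> bool"
  where "antipode \<Delta> E G1 G2 S \<longleftrightarrow>
    clinear S \<and> (\<forall>a b. S (a * b) = S b * S a) \<and>
    cvec.span {S a \<rhd> b | a b. True} = UNIV \<and> cvec.span {b \<lhd> S a | a b. True} = UNIV \<and>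
    (\<exists>R1 R2. clinear R1 \<and> clinear R2 \<and>
      (\<forall>a b c. (embed c \<otimes>\<^sub>M 1) \<rhd> R1 (a \<otimes> b) = tensor_lift (\<lambda>p q. p \<otimes> (S q \<rhd> b)) (T2 \<Delta> (c \<otimes> a))) \<and>
      (\<forall>a b c. R2 (a \<otimes> b) \<lhd> (1 \<otimes>\<^sub>M embed c) = tensor_lift (\<lambda>p q. (a \<lhd> S p) \<otimes> q) (T1 \<Delta> (b \<otimes> c))) \<and>
      (\<forall>x. E \<rhd> x = T1 \<Delta> (R1 x)) \<and> (\<forall>x. x \<lhd> E = T2 \<Delta> (R2 x)) \<and>
      (\<forall>x. G1 x = R1 (T1 \<Delta> x)) \<and> (\<forall>x. G2 x = R2 (T2 \<Delta> x)) \<and>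
      (\<forall>a b. tensor_lift (\<lambda>p q. S p \<rhd> q) (T1 \<Delta> (R1 (a \<otimes> b))) = S a \<rhd> b))"

locale regular_weak_multiplier_hopf_algebra = weak_multiplier_hopf_algebra \<Delta> \<epsilon> E G1 G2
  for \<Delta> :: "'a::complex_algebra \<Rightarrow> ('a \<otimes> 'a) multiplier" and \<epsilon> E G1 G2 +
  fixes S :: "'a \<Rightarrow> 'a multiplier"
  assumes antipode: "antipode \<Delta> E G1 G2 S"
    and antipode_bij: "bij_betw S UNIV (range embed)"

section \<open>Integrals, cointegrals and the dual\<close>

text \<open>\<open>\<epsilon>\<^sub>t(a) = \<Sum> a\<^sub>(\<^sub>1\<^sub>)S(a\<^sub>(\<^sub>2\<^sub>))\<close>, given by \<open>b\<epsilon>\<^sub>t(a) = \<Sum> ba\<^sub>(\<^sub>1\<^sub>)S(a\<^sub>(\<^sub>2\<^sub>))\<close>.\<close>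

definition counit_t ::
    "('a \<Rightarrow> ('a \<otimes> 'a) multiplier) \<Rightarrow> ('a \<Rightarrow> 'a multiplier) \<Rightarrow> 'a::complex_algebra \<Rightarrow> 'a multiplier"
  where "counit_t \<Delta> S a = (THE m. \<forall>b. b \<lhd> m = tensor_lift (\<lambda>p q. p \<lhd> S q) (T2 \<Delta> (b \<otimes> a)))"

definition target_algebra ::
    "('a \<Rightarrow> ('a \<otimes> 'a) multiplier) \<Rightarrow> ('a \<otimes> 'a) multiplier \<Rightarrow> 'a::complex_algebra multiplier set"
  where "target_algebra \<Delta> E = {x. extend_hom \<Delta> E x = (x \<otimes>\<^sub>M 1) * E}"

definition left_integral ::
    "('a \<Rightarrow> ('a \<otimes> 'a) multiplier) \<Rightarrow> ('a \<otimes> 'a) multiplier \<Rightarrow> ('a::complex_algebra \<Rightarrow> complex) \<Rightarrow> bool"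
  where "left_integral \<Delta> E \<phi> \<longleftrightarrow>
    clinear \<phi> \<and> \<phi> \<noteq> (\<lambda>_. 0) \<and> (\<forall>a. mslice_snd \<phi> (\<Delta> a) \<in> target_algebra \<Delta> E)"

definition faithful_integrals ::
    "('a::complex_algebra \<Rightarrow> ('a \<otimes> 'a) multiplier) \<Rightarrow> ('a \<otimes> 'a) multiplier \<Rightarrow> bool"
  where "faithful_integrals \<Delta> E \<longleftrightarrow>
    (\<forall>x. (\<forall>\<phi> a. left_integral \<Delta> E \<phi> \<longrightarrow> \<phi> (x * a) = 0) \<longrightarrow> x = 0) \<and>
    (\<forall>x. (\<forall>\<phi> a. left_integral \<Delta> E \<phi> \<longrightarrow> \<phi> (a * x) = 0) \<longrightarrow> x = 0)"

locale algebraic_quantum_groupoid = regular_weak_multiplier_hopf_algebra \<Delta> \<epsilon> E G1 G2 S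
  for \<Delta> :: "'a::complex_algebra \<Rightarrow> ('a \<otimes> 'a) multiplier" and \<epsilon> E G1 G2 S +
  assumes faithful_integrals: "faithful_integrals \<Delta> E"

definition left_cointegral ::
    "('a \<Rightarrow> ('a \<otimes> 'a) multiplier) \<Rightarrow> ('a \<Rightarrow> 'a multiplier) \<Rightarrow> 'a::complex_algebra multiplier \<Rightarrow> bool"
  where "left_cointegral \<Delta> S h \<longleftrightarrow> h \<noteq> 0 \<and> (\<forall>a. embed a * h = counit_t \<Delta> S a * h)"

text \<open>Faithfulness of a single cointegral \<open>h\<close> lying in \<open>A\<close>.\<close>

definition faithful_element :: "('a::complex_algebra \<Rightarrow> ('a \<otimes> 'a) multiplier) \<Rightarrow> 'a \<Rightarrow> bool"
  where "faithful_element \<Delta> h \<longleftrightarrow>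
    (\<forall>f. clinear f \<and> (mslice_snd f (\<Delta> h) = 0 \<or> mslice_fst f (\<Delta> h) = 0) \<longrightarrow> f = (\<lambda>_. 0))"

text \<open>
  The dual is the linear span in \<open>A'\<close> of the functionals \<open>\<phi>(\<cdot> b)\<close> with \<open>\<phi>\<close> a left integral, that is,
  the set of their finite sums; scalars are absorbed in the elements \<open>b\<close>.
\<close>

definition represents ::
    "('a \<Rightarrow> ('a \<otimes> 'a) multiplier) \<Rightarrow> ('a \<otimes> 'a) multiplier \<Rightarrow>
      (('a::complex_algebra \<Rightarrow> complex) \<times> 'a) list \<Rightarrow> ('a \<Rightarrow> complex) \<Rightarrow> bool"
  where "represents \<Delta> E xs \<omega> \<longleftrightarrow>
    (\<forall>(\<phi>, b) \<in> set xs. left_integral \<Delta> E \<phi>) \<and> \<omega> = (\<lambda>a. \<Sum>(\<phi>, b)\<leftarrow>xs. \<phi> (a * b))"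

definition dual ::
    "('a \<Rightarrow> ('a \<otimes> 'a) multiplier) \<Rightarrow> ('a \<otimes> 'a) multiplier \<Rightarrow> ('a::complex_algebra \<Rightarrow> complex) set"
  where "dual \<Delta> E = {\<omega>. \<exists>xs. represents \<Delta> E xs \<omega>}"

text \<open>
  \<open>(\<omega>\<omega>')(a) = (\<omega> \<otimes> \<omega>')\<Delta>(a)\<close>, where \<open>\<Delta>(a) \<in> M(A \<otimes> A)\<close>: for \<open>\<omega> = \<phi>(\<cdot> b)\<close> and \<open>\<omega>' = \<psi>(\<cdot> d)\<close> this is
  \<open>(\<phi> \<otimes> \<psi>)(\<Delta>(a)(b \<otimes> d))\<close>. The value does not depend on the representations: it equals both
  \<open>\<phi>(mb)\<close> with \<open>m = (id \<otimes> \<omega>')\<Delta>(a)\<close> and \<open>\<psi>(nd)\<close> with \<open>n = (\<omega> \<otimes> id)\<Delta>(a)\<close>.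
\<close>

definition dual_mult ::
    "('a \<Rightarrow> ('a \<otimes> 'a) multiplier) \<Rightarrow> ('a \<otimes> 'a) multiplier \<Rightarrow>
      ('a::complex_algebra \<Rightarrow> complex) \<Rightarrow> ('a \<Rightarrow> complex) \<Rightarrow> 'a \<Rightarrow> complex"
  where "dual_mult \<Delta> E \<omega> \<omega>' a = (THE z. \<forall>xs ys. represents \<Delta> E xs \<omega> \<and> represents \<Delta> E ys \<omega>' \<longrightarrow>
    z = (\<Sum>(\<phi>, b)\<leftarrow>xs. \<Sum>(\<psi>, d)\<leftarrow>ys. tensor_lift (\<lambda>p q. \<phi> p * \<psi> q) (\<Delta> a \<rhd> (b \<otimes> d))))"

text \<open>
  An algebraic quantum groupoid is of compact type if its underlying algebra (here given by a
  carrier and a product) has an identity.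
\<close>

definition compact_type :: "'b set \<Rightarrow> ('b \<Rightarrow> 'b \<Rightarrow> 'b) \<Rightarrow> bool"
  where "compact_type B mult \<longleftrightarrow> (\<exists>u\<in>B. \<forall>x\<in>B. mult u x = x \<and> mult x u = x)"

end

theory Submission
  imports Defs
begin

text \<open>
  The product of the dual is dual to \<open>\<Delta>\<close>, so the counit \<open>\<epsilon>\<close> is the natural candidate for its identity
  and \<open>\<epsilon>\<omega> = \<omega> = \<omega>\<epsilon>\<close> is the counit property (\<open>counit_is_unit\<close>). What has to be shown is that \<open>\<epsilon>\<close>
  lies in the dual, that is, \<open>\<epsilon> = \<Sum> \<phi>\<^sub>i(\<cdot> b\<^sub>i)\<close> for some left integrals \<open>\<phi>\<^sub>i\<close> and \<open>b\<^sub>i \<in> A\<close>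
  (\<open>counit_in_dual\<close>).

  Since \<open>h\<close> is faithful, a functional \<open>\<omega>\<close> is determined by \<open>(id \<otimes> \<omega>)\<Delta>(h)\<close>, and
  \<open>(id \<otimes> \<epsilon>)\<Delta>(h) = h\<close>. It therefore suffices to write
  \<open>h = \<Sum> (id \<otimes> \<phi>\<^sub>i)(\<Delta>(h)(1 \<otimes> b\<^sub>i))\<close>, because the right-hand side is \<open>(id \<otimes> \<omega>)\<Delta>(h)\<close> for
  \<open>\<omega> = \<Sum> \<phi>\<^sub>i(\<cdot> b\<^sub>i)\<close>. In fact such elements span all of \<open>A\<close> (\<open>integral_slices_span\<close>): if a
  functional \<open>f\<close> vanishes on all of them, then \<open>\<phi>(mb) = 0\<close> for all \<open>\<phi>\<close> and \<open>b\<close>, where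
  \<open>m = (f \<otimes> id)\<Delta>(h)\<close>. Faithfulness of the integrals gives \<open>m = 0\<close>, and then faithfulness of \<open>h\<close>,
  on its other leg, gives \<open>f = 0\<close>.

  These slices are multipliers of \<open>A\<close> only if \<open>\<Delta>(a)(b \<otimes> 1)\<close> and \<open>(1 \<otimes> b)\<Delta>(a)\<close> lie in \<open>A \<otimes> A\<close>,
  which follows from the bijectivity of the antipode (\<open>regular_cover\<close>).
\<close>

section \<open>Slices of tensors\<close>

lemma clinear_sum_list_functional:
  fixes f :: "'b \<Rightarrow> 'a::complex_vec \<Rightarrow> complex"
  assumes "\<And>x. x \<in> set xs \<Longrightarrow> clinear (f x)"
  shows "clinear (\<lambda>a. \<Sum>x\<leftarrow>xs. f x a)"
  using assms
proof (induction xs)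
  case Nil
  show ?case by (rule clinearI) simp_all
next
  case (Cons x xs)
  then have "clinear (f x)" "clinear (\<lambda>a. \<Sum>x\<leftarrow>xs. f x a)" by auto
  then show ?case
    by (simp add: cvec_pair.linear_compose_add)
qed

lemma
  fixes f :: "'a::complex_vec \<Rightarrow> complex"
  assumes "clinear f"
  shows clinear_slice_fst: "clinear (slice_fst f)"
    and slice_fst_pure: "slice_fst f (a \<otimes> b) = f a *\<^sub>C b"
    and clinear_slice_snd: "clinear (slice_snd f)"
    and slice_snd_pure: "slice_snd f (a \<otimes> b) = f b *\<^sub>C a"
proof -
  have b: "cbilinear (\<lambda>a b. f a *\<^sub>C b)" "cbilinear (\<lambda>a b. f b *\<^sub>C a)"
    by (rule cbilinearI; simp add: clinear_add[OF assms] clinear_scale[OF assms] scaleC_complex_def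
        scaleC_add_left scaleC_add_right scaleC_scaleC mult.commute)+
  show "clinear (slice_fst f)" "slice_fst f (a \<otimes> b) = f a *\<^sub>C b"
    "clinear (slice_snd f)" "slice_snd f (a \<otimes> b) = f b *\<^sub>C a"
    unfolding slice_fst_def slice_snd_def
    using clinear_tensor_lift[OF b(1)] clinear_tensor_lift[OF b(2)]
      tensor_lift_pure[OF b(1)] tensor_lift_pure[OF b(2)] by simp_all
qed

lemma
  fixes f g :: "'a::complex_vec \<Rightarrow> complex"
  assumes "clinear f" "clinear g"
  shows tensor_lift_eq_slice_fst: "tensor_lift (\<lambda>p q. f p * g q) t = g (slice_fst f t)"
    and tensor_lift_eq_slice_snd: "tensor_lift (\<lambda>p q. f p * g q) t = f (slice_snd g t)"
proof -
  have b: "cbilinear (\<lambda>p q. f p * g q)"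
    by (rule cbilinearI) (simp_all add: clinear_add[OF assms(1)] clinear_scale[OF assms(1)]
      clinear_add[OF assms(2)] clinear_scale[OF assms(2)] scaleC_complex_def algebra_simps)
  note l = clinear_tensor_lift[OF b]
  show "tensor_lift (\<lambda>p q. f p * g q) t = g (slice_fst f t)"
    by (rule fun_cong[OF clinear_tensor_ext[OF l
          clinear_compose[OF clinear_slice_fst[OF assms(1)] assms(2)]]])
      (simp add: tensor_lift_pure[OF b] slice_fst_pure[OF assms(1)] clinear_scale[OF assms(2)]
        scaleC_complex_def)
  show "tensor_lift (\<lambda>p q. f p * g q) t = f (slice_snd g t)"
    by (rule fun_cong[OF clinear_tensor_ext[OF l
          clinear_compose[OF clinear_slice_snd[OF assms(2)] assms(1)]]])
      (simp add: tensor_lift_pure[OF b] slice_snd_pure[OF assms(2)] clinear_scale[OF assms(1)]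
        scaleC_complex_def)
qed

text \<open>Both sides are \<open>(f \<otimes> g)t\<close>.\<close>

lemma functional_slice_swap:
  fixes f g :: "'a::complex_vec \<Rightarrow> complex"
  assumes "clinear f" "clinear g"
  shows "g (slice_fst f t) = f (slice_snd g t)"
  using tensor_lift_eq_slice_fst[OF assms] tensor_lift_eq_slice_snd[OF assms] by metis

text \<open>
  In coordinates: if \<open>B\<close> is a basis with coordinate functionals \<open>b\<^sup>*\<close>, then every tensor \<open>t\<close> is a
  finite sum of the elements \<open>b \<otimes> (b\<^sup>* \<otimes> id)t\<close>.
\<close>

lemma slices_separate_tensors:
  fixes t :: "'a::complex_vec \<otimes> 'a"
  assumes "\<And>g. clinear g \<Longrightarrow> slice_fst g t = 0"
  shows "t = 0"
proof -
  obtain B :: "'a set" where B: "cvec.independent B" "UNIV \<subseteq> cvec.span B"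
    using cvec.basis_exists[of UNIV] by blast
  then have sp: "x \<in> cvec.span B" for x by auto
  let ?r = "\<lambda>b x. cvec.representation B x b"
  have lin: "clinear (?r b)" for b
    by (rule clinearI)
      (simp_all add: cvec.representation_add[OF B(1) sp sp] cvec.representation_scale[OF B(1) sp]
        scaleC_complex_def)
  have "\<exists>F. finite F \<and> (\<forall>F'. finite F' \<and> F \<subseteq> F' \<longrightarrow> t = (\<Sum>b\<in>F'. b \<otimes> slice_fst (?r b) t))"
  proof (induction t rule: tensor_induct)
    case zero
    show ?case
      by (rule exI[of _ "{}"])
        (simp add: clinear_0[OF clinear_slice_fst[OF lin]] cvec_pair.linear_0
          cbilinear_pure_tensor[unfolded cbilinear_def])
  next
    case (pure x y)
    let ?F = "{b. ?r b x \<noteq> 0}"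
    have "x \<otimes> y = (\<Sum>b\<in>F'. b \<otimes> slice_fst (?r b) (x \<otimes> y))" if F: "finite F'" "?F \<subseteq> F'" for F'
    proof -
      have "x = (\<Sum>b\<in>?F. ?r b x *\<^sub>C b)"
        by (rule cvec.sum_nonzero_representation_eq[OF B(1) sp, symmetric])
      also have "\<dots> = (\<Sum>b\<in>F'. ?r b x *\<^sub>C b)"
        by (rule sum.mono_neutral_left) (use F in auto)
      finally have "x \<otimes> y = (\<Sum>b\<in>F'. ?r b x *\<^sub>C b) \<otimes> y" by simp
      also have "\<dots> = (\<Sum>b\<in>F'. (?r b x *\<^sub>C b) \<otimes> y)"
        using cbilinear_pure_tensor[unfolded cbilinear_def] cvec_pair.linear_sum by blast
      also have "\<dots> = (\<Sum>b\<in>F'. b \<otimes> slice_fst (?r b) (x \<otimes> y))"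
        by (simp add: slice_fst_pure[OF lin] pure_tensor_simps)
      finally show ?thesis .
    qed
    moreover have "finite ?F" by (rule cvec.finite_representation)
    ultimately show ?case by blast
  next
    case (add s t)
    then obtain F1 F2 where
      "finite F1" "\<forall>F'. finite F' \<and> F1 \<subseteq> F' \<longrightarrow> s = (\<Sum>b\<in>F'. b \<otimes> slice_fst (?r b) s)"
      "finite F2" "\<forall>F'. finite F' \<and> F2 \<subseteq> F' \<longrightarrow> t = (\<Sum>b\<in>F'. b \<otimes> slice_fst (?r b) t)"
      by blast
    then show ?case
      by (intro exI[of _ "F1 \<union> F2"])
        (simp add: clinear_add[OF clinear_slice_fst[OF lin]] pure_tensor_simps sum.distrib)
  qed
  then obtain F where F: "finite F" "\<forall>F'. finite F' \<and> F \<subseteq> F' \<longrightarrow> t = (\<Sum>b\<in>F'. b \<otimes> slice_fst (?r b) t)"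
    by blast
  then have "t = (\<Sum>b\<in>F. b \<otimes> slice_fst (?r b) t)" by blast
  also have "\<dots> = 0"
    by (simp add: assms[OF lin] cvec_pair.linear_0 cbilinear_pure_tensor[unfolded cbilinear_def])
  finally show ?thesis .
qed

lemma subspace_separation:
  fixes x :: "'a::complex_vec"
  assumes "x \<notin> cvec.span U"
  obtains f :: "'a \<Rightarrow> complex" where "clinear f" "\<And>u. u \<in> U \<Longrightarrow> f u = 0" "f x = 1"
proof -
  obtain B where B: "B \<subseteq> U" "cvec.independent B" "U \<subseteq> cvec.span B"
    using cvec.maximal_independent_subset[of U] by blast
  have x: "x \<notin> cvec.span B"
    using assms cvec.span_mono[OF B(1)] by blast
  then have "cvec.independent (insert x B)"
    using B(2) by (simp add: cvec.independent_insert)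
  then obtain f :: "'a \<Rightarrow> complex" where f: "clinear f" "\<forall>y\<in>insert x B. f y = (if y = x then 1 else 0)"
    using cvec_pair.linear_independent_extend[of "insert x B" "\<lambda>y. if y = x then 1 else 0"] by blast
  have "x \<notin> B" using x cvec.span_base by blast
  then have "\<And>u. u \<in> B \<Longrightarrow> f u = 0" using f(2) by auto
  then have "f u = 0" if "u \<in> U" for u
    using cvec_pair.linear_eq_0_on_span[OF f(1)] B(3) that by blast
  then show ?thesis using that f by simp
qed

section \<open>Multipliers\<close>

lemma lact_ract: "a * (m \<rhd> b) = (a \<lhd> m) * b"
  and lact_mult: "m \<rhd> (a * b) = (m \<rhd> a) * b"
  and ract_mult: "(a * b) \<lhd> m = a * (b \<lhd> m)"
  by (transfer, auto)+

lemma embed_linear: "embed (s + t) = embed s + embed t" "embed (c *\<^sub>C s) = c *\<^sub>C embed s"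
  by (transfer; simp add: distrib_left distrib_right scaleC_mult_left scaleC_mult_right fun_eq_iff)+

lemma mult_embed: "m * embed a = embed (m \<rhd> a)"
  and embed_mult: "embed a * m = embed (a \<lhd> m)"
  by (rule multiplier_eqI; simp add: lact_ract lact_mult ract_mult)+

lemma mtensor_mult: "(m \<otimes>\<^sub>M n) * (m' \<otimes>\<^sub>M n') = (m * m') \<otimes>\<^sub>M (n * n')"
proof (rule multiplier_eqI)
  fix t
  show "((m \<otimes>\<^sub>M n) * (m' \<otimes>\<^sub>M n')) \<rhd> t = ((m * m') \<otimes>\<^sub>M (n * n')) \<rhd> t"
    by (induction t rule: tensor_induct) (simp_all add: act_linear clinear_0[OF clinear_lact])
  show "t \<lhd> ((m \<otimes>\<^sub>M n) * (m' \<otimes>\<^sub>M n')) = t \<lhd> ((m * m') \<otimes>\<^sub>M (n * n'))"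
    by (induction t rule: tensor_induct) (simp_all add: act_linear clinear_0[OF clinear_ract])
qed

lemma embed_pure_tensor: "embed a \<otimes>\<^sub>M embed b = embed (a \<otimes> b)"
proof (rule multiplier_eqI)
  fix t
  show "(embed a \<otimes>\<^sub>M embed b) \<rhd> t = embed (a \<otimes> b) \<rhd> t"
    by (induction t rule: tensor_induct)
      (simp_all add: act_linear clinear_0[OF clinear_lact] tensor_mult_pure distrib_left)
  show "t \<lhd> (embed a \<otimes>\<^sub>M embed b) = t \<lhd> embed (a \<otimes> b)"
    by (induction t rule: tensor_induct)
      (simp_all add: act_linear clinear_0[OF clinear_ract] tensor_mult_pure distrib_right)
qed

lemma mtensor_legs_commute:
  "(1 \<otimes>\<^sub>M n) * (m \<otimes>\<^sub>M 1) = (m \<otimes>\<^sub>M 1) * (1 \<otimes>\<^sub>M n)"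
  by (simp add: mtensor_mult)

lemma slice_acts:
  fixes f :: "'a::complex_algebra \<Rightarrow> complex"
  assumes "clinear f"
  shows "slice_fst f (t \<lhd> (1 \<otimes>\<^sub>M m)) = slice_fst f t \<lhd> m"
    and "slice_fst f ((1 \<otimes>\<^sub>M m) \<rhd> t) = m \<rhd> slice_fst f t"
    and "slice_snd f (t \<lhd> (m \<otimes>\<^sub>M 1)) = slice_snd f t \<lhd> m"
    and "slice_snd f ((m \<otimes>\<^sub>M 1) \<rhd> t) = m \<rhd> slice_snd f t"
proof -
  note f = clinear_slice_fst[OF assms] clinear_slice_snd[OF assms]
  note simps = act_linear clinear_0[OF clinear_lact] clinear_0[OF clinear_ract]
    clinear_0[OF f(1)] clinear_0[OF f(2)] clinear_add[OF f(1)] clinear_add[OF f(2)]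
    slice_fst_pure[OF assms] slice_snd_pure[OF assms]
  show "slice_fst f (t \<lhd> (1 \<otimes>\<^sub>M m)) = slice_fst f t \<lhd> m"
    "slice_fst f ((1 \<otimes>\<^sub>M m) \<rhd> t) = m \<rhd> slice_fst f t"
    "slice_snd f (t \<lhd> (m \<otimes>\<^sub>M 1)) = slice_snd f t \<lhd> m"
    "slice_snd f ((m \<otimes>\<^sub>M 1) \<rhd> t) = m \<rhd> slice_snd f t"
    by (induction t rule: tensor_induct; simp add: simps)+
qed

lemma clinear_mult_right_functional:
  fixes \<phi> :: "'a::complex_algebra \<Rightarrow> complex"
  assumes "clinear \<phi>"
  shows "clinear (\<lambda>a. \<phi> (a * b))"
  by (rule clinearI)
    (simp_all add: distrib_right scaleC_mult_left clinear_add[OF assms] clinear_scale[OF assms])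

lemma slice_mult_right_functional:
  fixes \<phi> :: "'a::complex_algebra \<Rightarrow> complex"
  assumes "clinear \<phi>"
  shows "slice_fst (\<lambda>a. \<phi> (a * b)) t = slice_fst \<phi> (t \<lhd> (embed b \<otimes>\<^sub>M 1))"
    and "slice_snd (\<lambda>a. \<phi> (a * b)) t = slice_snd \<phi> (t \<lhd> (1 \<otimes>\<^sub>M embed b))"
proof -
  note l = clinear_mult_right_functional[OF assms, of b]
  note f = clinear_slice_fst[OF assms] clinear_slice_snd[OF assms]
    clinear_slice_fst[OF l] clinear_slice_snd[OF l]
  note simps = act_linear clinear_0[OF clinear_ract]
    f[THEN clinear_0] f[THEN clinear_add] slice_fst_pure[OF assms] slice_snd_pure[OF assms]
    slice_fst_pure[OF l] slice_snd_pure[OF l]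
  show "slice_fst (\<lambda>a. \<phi> (a * b)) t = slice_fst \<phi> (t \<lhd> (embed b \<otimes>\<^sub>M 1))"
    "slice_snd (\<lambda>a. \<phi> (a * b)) t = slice_snd \<phi> (t \<lhd> (1 \<otimes>\<^sub>M embed b))"
    by (induction t rule: tensor_induct; simp add: simps)+
qed

lemma slice_functional_add:
  fixes f g :: "'a::complex_algebra \<Rightarrow> complex"
  assumes "clinear f" "clinear g"
  shows "slice_fst (\<lambda>a. f a + g a) t = slice_fst f t + slice_fst g t"
    and "slice_snd (\<lambda>a. f a + g a) t = slice_snd f t + slice_snd g t"
proof -
  have l: "clinear (\<lambda>a. f a + g a)"
    using assms by (rule cvec_pair.linear_compose_add)
  note L = assms l
  note simps = L[THEN clinear_slice_fst, THEN clinear_0] L[THEN clinear_slice_snd, THEN clinear_0]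
    L[THEN clinear_slice_fst, THEN clinear_add] L[THEN clinear_slice_snd, THEN clinear_add]
    L[THEN slice_fst_pure] L[THEN slice_snd_pure] scaleC_add_left
  show "slice_fst (\<lambda>a. f a + g a) t = slice_fst f t + slice_fst g t"
    "slice_snd (\<lambda>a. f a + g a) t = slice_snd f t + slice_snd g t"
    by (induction t rule: tensor_induct; simp add: simps algebra_simps)+
qed

lemma slice_functional_zero:
  "slice_fst (\<lambda>_. 0) t = 0" "slice_snd (\<lambda>_. 0) t = (0 :: 'a::complex_vec)"
proof -
  have l: "clinear (\<lambda>_. 0 :: complex)" by (rule clinearI) simp_all
  note simps = clinear_slice_fst[OF l, THEN clinear_0] clinear_slice_snd[OF l, THEN clinear_0]
    clinear_slice_fst[OF l, THEN clinear_add] clinear_slice_snd[OF l, THEN clinear_add]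
    slice_fst_pure[OF l] slice_snd_pure[OF l]
  show "slice_fst (\<lambda>_. 0) t = 0" "slice_snd (\<lambda>_. 0) t = (0 :: 'a::complex_vec)"
    by (induction t rule: tensor_induct; simp add: simps)+
qed

lemma slice_sum_list_functional:
  fixes xs :: "(('a::complex_algebra \<Rightarrow> complex) \<times> 'a) list"
  assumes "\<forall>(\<phi>, b) \<in> set xs. clinear \<phi>"
  shows "slice_fst (\<lambda>a. \<Sum>(\<phi>, b)\<leftarrow>xs. \<phi> (a * b)) t
      = (\<Sum>(\<phi>, b)\<leftarrow>xs. slice_fst \<phi> (t \<lhd> (embed b \<otimes>\<^sub>M 1)))" (is "?fst xs")
    and "slice_snd (\<lambda>a. \<Sum>(\<phi>, b)\<leftarrow>xs. \<phi> (a * b)) t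
      = (\<Sum>(\<phi>, b)\<leftarrow>xs. slice_snd \<phi> (t \<lhd> (1 \<otimes>\<^sub>M embed b)))" (is "?snd xs")
proof -
  have "?fst xs \<and> ?snd xs"
    using assms
  proof (induction xs)
    case Nil
    show ?case by (simp add: slice_functional_zero)
  next
    case (Cons x xs)
    obtain \<phi> b where x: "x = (\<phi>, b)" by fastforce
    with Cons.prems have \<phi>: "clinear \<phi>" by simp
    have xs: "clinear (\<lambda>a. \<Sum>(\<phi>, b)\<leftarrow>xs. \<phi> (a * b))"
      unfolding case_prod_unfold
      by (rule clinear_sum_list_functional, rule clinear_mult_right_functional)
        (use Cons.prems in auto)
    show ?case
      using Cons slice_functional_add[OF clinear_mult_right_functional[OF \<phi>, of b] xs]
      by (simp add: x slice_mult_right_functional[OF \<phi>])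
  qed
  then show "?fst xs" "?snd xs" by auto
qed

section \<open>Non-degeneracy and covered coproducts\<close>

context weak_multiplier_hopf_algebra
begin

lemma nondegenerate_left: "(\<And>b. a * b = 0) \<Longrightarrow> a = (0::'a)"
  and nondegenerate_right: "(\<And>b. b * a = 0) \<Longrightarrow> a = (0::'a)"
  using nondegenerate_idempotent unfolding nondegenerate_idempotent_algebra_def by blast+

text \<open>
  Slicing both legs reduces non-degeneracy of \<open>A \<otimes> A\<close> to that of \<open>A\<close>: if \<open>(a \<otimes> b)t = 0\<close> for all
  \<open>a\<close> and \<open>b\<close>, then \<open>a (id \<otimes> f)((1 \<otimes> b)t) = 0\<close>, so \<open>a\<close> can be dropped; reading the result as
  \<open>f(b (g \<otimes> id)t) = 0\<close> for all \<open>f\<close> and \<open>g\<close>, so can \<open>b\<close>.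
\<close>

lemma tensor_nondegenerate:
  fixes t :: "'a \<otimes> 'a"
  shows "(\<And>a b. (a \<otimes> b) * t = 0) \<Longrightarrow> t = 0"
    and "(\<And>a b. t * (a \<otimes> b) = 0) \<Longrightarrow> t = 0"
proof -
  show "t = 0" if z: "\<And>a b. (a \<otimes> b) * t = 0"
  proof (rule slices_separate_tensors)
    fix g :: "'a \<Rightarrow> complex" assume g: "clinear g"
    have "b * slice_fst g t = 0" for b
    proof (rule clinear_separates)
      fix f :: "'a \<Rightarrow> complex" assume f: "clinear f"
      have "slice_snd f ((1 \<otimes>\<^sub>M embed b) \<rhd> t) = 0"
      proof (rule nondegenerate_right)
        fix a
        have "(embed a \<otimes>\<^sub>M 1) \<rhd> (1 \<otimes>\<^sub>M embed b) \<rhd> t = (a \<otimes> b) * t"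
          by (metis act_simps(1) act_simps(3) embed_pure_tensor mtensor_mult mult_1 mult_1_right)
        then show "a * slice_snd f ((1 \<otimes>\<^sub>M embed b) \<rhd> t) = 0"
          using z[of a b] slice_acts(4)[OF f, of "embed a" "(1 \<otimes>\<^sub>M embed b) \<rhd> t"]
            clinear_0[OF clinear_slice_snd[OF f]]
          by simp
      qed
      then show "f (b * slice_fst g t) = 0"
        using functional_slice_swap[OF g f, of "(1 \<otimes>\<^sub>M embed b) \<rhd> t"] slice_acts(2)[OF g, of "embed b" t]
          clinear_0[OF g] by simp
    qed
    then show "slice_fst g t = 0" by (rule nondegenerate_right)
  qed
  show "t = 0" if z: "\<And>a b. t * (a \<otimes> b) = 0"
  proof (rule slices_separate_tensors)
    fix g :: "'a \<Rightarrow> complex" assume g: "clinear g"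
    have "slice_fst g t * b = 0" for b
    proof (rule clinear_separates)
      fix f :: "'a \<Rightarrow> complex" assume f: "clinear f"
      have "slice_snd f (t \<lhd> (1 \<otimes>\<^sub>M embed b)) = 0"
      proof (rule nondegenerate_left)
        fix a
        have "t \<lhd> (1 \<otimes>\<^sub>M embed b) \<lhd> (embed a \<otimes>\<^sub>M 1) = t * (a \<otimes> b)"
          by (metis act_simps(2) act_simps(4) embed_pure_tensor mtensor_mult mult_1 mult_1_right)
        then show "slice_snd f (t \<lhd> (1 \<otimes>\<^sub>M embed b)) * a = 0"
          using z[of a b] slice_acts(3)[OF f, of "t \<lhd> (1 \<otimes>\<^sub>M embed b)" "embed a"]
            clinear_0[OF clinear_slice_snd[OF f]]
          by simp
      qed
      then show "f (slice_fst g t * b) = 0"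
        using functional_slice_swap[OF g f, of "t \<lhd> (1 \<otimes>\<^sub>M embed b)"] slice_acts(1)[OF g, of t "embed b"]
          clinear_0[OF g] by simp
    qed
    then show "slice_fst g t = 0" by (rule nondegenerate_left)
  qed
qed

lemma embed_inject: "embed (a::'a) = embed b \<longleftrightarrow> a = b"
proof
  assume "embed a = embed b"
  then have "(a - b) * c = 0" for c
    by (metis act_simps(1) left_diff_distrib right_minus_eq)
  then show "a = b" using nondegenerate_left by (metis right_minus_eq)
qed simp

lemma embed_tensor_inject: "embed (s :: 'a \<otimes> 'a) = embed t \<longleftrightarrow> s = t"
proof
  assume "embed s = embed t"
  then have "(s - t) * c = 0" for c
    by (metis act_simps(1) left_diff_distrib right_minus_eq)
  then show "s = t" using tensor_nondegenerate(2) by (metis right_minus_eq)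
qed simp

lemma unembed_tensor [simp]: "unembed (embed (t :: 'a \<otimes> 'a)) = t"
  unfolding unembed_def by (rule the_equality) (simp_all add: embed_tensor_inject)

lemma embed_unembed_tensor: "x \<in> range embed \<Longrightarrow> embed (unembed x) = (x :: ('a \<otimes> 'a) multiplier)"
  by auto

text \<open>
  Covering the other leg as well turns the equation into one between elements of \<open>A \<otimes> A\<close>. By
  non-degeneracy of \<open>A \<otimes> A\<close>, the action of a multiplier on one side determines that on the other.
\<close>

lemma multiplier_tensor_eqI:
  fixes x y :: "('a \<otimes> 'a) multiplier"
  shows "(\<And>c. (embed c \<otimes>\<^sub>M 1) * x = (embed c \<otimes>\<^sub>M 1) * y) \<Longrightarrow> x = y"
    and "(\<And>c. x * (1 \<otimes>\<^sub>M embed c) = y * (1 \<otimes>\<^sub>M embed c)) \<Longrightarrow> x = y"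
proof -
  show "x = y" if eq: "\<And>c. (embed c \<otimes>\<^sub>M 1) * x = (embed c \<otimes>\<^sub>M 1) * y"
  proof -
    have "embed (c \<otimes> d) * x = embed (c \<otimes> d) * y" for c d :: 'a
    proof -
      have "embed (c \<otimes> d) = (1 \<otimes>\<^sub>M embed d) * (embed c \<otimes>\<^sub>M 1)"
        by (simp add: mtensor_mult embed_pure_tensor)
      then show ?thesis using eq[of c] by (simp add: mult.assoc)
    qed
    then have p: "(c \<otimes> d) \<lhd> x = (c \<otimes> d) \<lhd> y" for c d :: 'a
      by (simp add: embed_mult embed_tensor_inject)
    have r: "t \<lhd> x = t \<lhd> y" for t
      using clinear_tensor_ext[OF clinear_ract clinear_ract p] by metis
    have "s * (x \<rhd> t - y \<rhd> t) = 0" for s t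
      by (simp add: right_diff_distrib lact_ract r)
    then have "x \<rhd> t - y \<rhd> t = 0" for t by (rule tensor_nondegenerate(1))
    then show ?thesis by (intro multiplier_eqI) (simp_all add: r)
  qed
  show "x = y" if eq: "\<And>c. x * (1 \<otimes>\<^sub>M embed c) = y * (1 \<otimes>\<^sub>M embed c)"
  proof -
    have "x * embed (c \<otimes> d) = y * embed (c \<otimes> d)" for c d :: 'a
    proof -
      have "embed (c \<otimes> d) = (1 \<otimes>\<^sub>M embed d) * (embed c \<otimes>\<^sub>M 1)"
        by (simp add: mtensor_mult embed_pure_tensor)
      then show ?thesis using eq[of d] by (simp add: mult.assoc[symmetric])
    qed
    then have p: "x \<rhd> (c \<otimes> d) = y \<rhd> (c \<otimes> d)" for c d :: 'a
      by (simp add: mult_embed embed_tensor_inject)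
    have r: "x \<rhd> t = y \<rhd> t" for t
      using clinear_tensor_ext[OF clinear_lact clinear_lact p] by metis
    have "(t \<lhd> x - t \<lhd> y) * s = 0" for s t
      by (simp add: left_diff_distrib lact_ract[symmetric] r)
    then have "t \<lhd> x - t \<lhd> y = 0" for t by (rule tensor_nondegenerate(2))
    then show ?thesis by (intro multiplier_eqI) (simp_all add: r)
  qed
qed

lemma cbilinear_unembed:
  fixes x :: "'a \<Rightarrow> 'a \<Rightarrow> ('a \<otimes> 'a) multiplier"
  assumes "cbilinear x" "\<And>a b. x a b \<in> range embed"
  shows "cbilinear (\<lambda>a b. unembed (x a b))"
proof -
  have u: "unembed (m + n) = unembed m + unembed n"
    if "m \<in> range embed" "n \<in> range embed" for m n :: "('a \<otimes> 'a) multiplier"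
    using that by (auto simp: embed_linear[symmetric])
  have uc: "unembed (c *\<^sub>C m) = c *\<^sub>C unembed m"
    if "m \<in> range embed" for m :: "('a \<otimes> 'a) multiplier" and c
    using that by (auto simp: embed_linear[symmetric])
  show ?thesis
    by (rule cbilinearI) (simp_all add: cbilinearD[OF assms(1)] u uc assms(2))
qed

lemma mtensor_embed_linear:
  "1 \<otimes>\<^sub>M embed (a + b) = (1 \<otimes>\<^sub>M embed a + 1 \<otimes>\<^sub>M embed b :: ('a \<otimes> 'a) multiplier)"
  "1 \<otimes>\<^sub>M embed (c *\<^sub>C a) = (c *\<^sub>C (1 \<otimes>\<^sub>M embed a) :: ('a \<otimes> 'a) multiplier)"
  "embed (a + b) \<otimes>\<^sub>M 1 = (embed a \<otimes>\<^sub>M 1 + embed b \<otimes>\<^sub>M 1 :: ('a \<otimes> 'a) multiplier)"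
  "embed (c *\<^sub>C a) \<otimes>\<^sub>M 1 = (c *\<^sub>C (embed a \<otimes>\<^sub>M 1) :: ('a \<otimes> 'a) multiplier)"
proof -
  have act: "(m + n) \<rhd> x = m \<rhd> x + n \<rhd> x" "x \<lhd> (m + n) = x \<lhd> m + x \<lhd> n"
    "(c *\<^sub>C m) \<rhd> x = c *\<^sub>C (m \<rhd> x)" "x \<lhd> (c *\<^sub>C m) = c *\<^sub>C (x \<lhd> m)"
    for c and m n :: "('a \<otimes> 'a) multiplier" and x
    by (transfer, simp)+
  note simps = act act_linear clinear_0[OF clinear_lact] clinear_0[OF clinear_ract]
    distrib_left distrib_right pure_tensor_simps scaleC_mult_left scaleC_mult_right scaleC_add_right
    add_ac
  show "1 \<otimes>\<^sub>M embed (a + b) = (1 \<otimes>\<^sub>M embed a + 1 \<otimes>\<^sub>M embed b :: ('a \<otimes> 'a) multiplier)"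
    "1 \<otimes>\<^sub>M embed (c *\<^sub>C a) = (c *\<^sub>C (1 \<otimes>\<^sub>M embed a) :: ('a \<otimes> 'a) multiplier)"
    "embed (a + b) \<otimes>\<^sub>M 1 = (embed a \<otimes>\<^sub>M 1 + embed b \<otimes>\<^sub>M 1 :: ('a \<otimes> 'a) multiplier)"
    "embed (c *\<^sub>C a) \<otimes>\<^sub>M 1 = (c *\<^sub>C (embed a \<otimes>\<^sub>M 1) :: ('a \<otimes> 'a) multiplier)"
    by (rule multiplier_eqI; rename_tac t; induct_tac t rule: tensor_induct; simp add: simps)+
qed

lemma
  shows clinear_T1: "clinear (T1 \<Delta>)"
    and embed_T1: "embed (T1 \<Delta> (a \<otimes> b)) = \<Delta> a * (1 \<otimes>\<^sub>M embed b)"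
    and embed_T2: "embed (T2 \<Delta> (a \<otimes> b)) = (embed a \<otimes>\<^sub>M 1) * \<Delta> b"
proof -
  have 1: "cbilinear (\<lambda>a b. unembed (\<Delta> a * (1 \<otimes>\<^sub>M embed b)))"
    by (rule cbilinear_unembed[OF _ coproduct_cover(1)], rule cbilinearI)
      (simp_all add: clinear_add[OF coproduct_linear] clinear_scale[OF coproduct_linear]
        mtensor_embed_linear distrib_left distrib_right scaleC_mult_left scaleC_mult_right)
  have 2: "cbilinear (\<lambda>a b. unembed ((embed a \<otimes>\<^sub>M 1) * \<Delta> b))"
    by (rule cbilinear_unembed[OF _ coproduct_cover(2)], rule cbilinearI)
      (simp_all add: clinear_add[OF coproduct_linear] clinear_scale[OF coproduct_linear]
        mtensor_embed_linear distrib_left distrib_right scaleC_mult_left scaleC_mult_right)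
  show "clinear (T1 \<Delta>)"
    using 1 by (simp add: T1_def clinear_tensor_lift)
  show "embed (T1 \<Delta> (a \<otimes> b)) = \<Delta> a * (1 \<otimes>\<^sub>M embed b)"
    by (simp add: T1_def tensor_lift_pure[OF 1] embed_unembed_tensor[OF coproduct_cover(1)])
  show "embed (T2 \<Delta> (a \<otimes> b)) = (embed a \<otimes>\<^sub>M 1) * \<Delta> b"
    by (simp add: T2_def tensor_lift_pure[OF 2] embed_unembed_tensor[OF coproduct_cover(2)])
qed

lemma counit_linear: "clinear \<epsilon>"
  and counit_fst: "slice_fst \<epsilon> (T1 \<Delta> (a \<otimes> b)) = a * b"
  and counit_snd: "slice_snd \<epsilon> (T2 \<Delta> (c \<otimes> a)) = c * a"
  using counit by (auto simp: counit_def)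

end

context regular_weak_multiplier_hopf_algebra
begin

lemma antipode_on_algebra:
  obtains \<sigma> where "\<And>a. S a = embed (\<sigma> a)" "bij \<sigma>" "clinear \<sigma>" "\<And>a b. \<sigma> (a * b) = \<sigma> b * \<sigma> a"
proof -
  from antipode have S: "clinear S" "\<And>a b. S (a * b) = S b * S a"
    by (auto simp: antipode_def)
  have "\<exists>s. S a = embed s" for a
    using antipode_bij by (auto simp: bij_betw_def)
  then obtain \<sigma> where \<sigma>: "\<And>a. S a = embed (\<sigma> a)" by metis
  have "clinear \<sigma>"
    by (rule clinearI; subst embed_inject[symmetric])
      (simp_all only: embed_linear \<sigma>[symmetric] clinear_add[OF S(1)] clinear_scale[OF S(1)])
  moreover have "\<sigma> (a * b) = \<sigma> b * \<sigma> a" for a b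
    by (subst embed_inject[symmetric]) (use S(2)[of a b] in \<open>simp add: \<sigma> mult_embed\<close>)
  moreover have "inj \<sigma>"
  proof (rule injI)
    fix a b assume "\<sigma> a = \<sigma> b"
    then have "S a = S b" by (simp add: \<sigma>)
    then show "a = b" using antipode_bij by (auto simp: bij_betw_def inj_on_def)
  qed
  moreover have "surj \<sigma>"
  proof -
    have "\<exists>a. b = \<sigma> a" for b
    proof -
      have "embed b \<in> range S" using antipode_bij by (auto simp: bij_betw_def)
      then obtain a where "embed b = S a" by blast
      then show ?thesis by (auto simp: \<sigma> embed_inject)
    qed
    then show ?thesis by blast
  qed
  ultimately show ?thesis using that \<sigma> by (simp add: bij_def)
qed

text \<open>
  \<open>\<Sum> a\<^sub>(\<^sub>1\<^sub>) \<otimes> S(a\<^sub>(\<^sub>2\<^sub>))S(b) = \<Sum> a\<^sub>(\<^sub>1\<^sub>) \<otimes> S(ba\<^sub>(\<^sub>2\<^sub>))\<close> lies in \<open>A \<otimes> A\<close>, and so does its image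
  \<open>(1 \<otimes> b)\<Delta>(a)\<close> under \<open>id \<otimes> S\<^sup>-\<^sup>1\<close>. For \<open>\<Delta>(a)(b \<otimes> 1)\<close> the argument is the same with
  \<open>\<Sum> S(b)S(a\<^sub>(\<^sub>1\<^sub>)) \<otimes> a\<^sub>(\<^sub>2\<^sub>)\<close>.
\<close>

lemma regular_cover:
  "(1 \<otimes>\<^sub>M embed b) * \<Delta> a \<in> range embed" "\<Delta> a * (embed b \<otimes>\<^sub>M 1) \<in> range embed"
proof -
  obtain \<sigma> where \<sigma>: "\<And>a. S a = embed (\<sigma> a)" "bij \<sigma>" "clinear \<sigma>" "\<And>a b. \<sigma> (a * b) = \<sigma> b * \<sigma> a"
    by (rule antipode_on_algebra) blast
  have inv: "\<sigma> (inv \<sigma> x) = x" "inv \<sigma> (\<sigma> x) = x" for x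
    using \<sigma>(2) by (simp_all add: bij_is_surj surj_f_inv_f bij_is_inj)
  have lin: "clinear (inv \<sigma>)"
    by (rule clinearI; subst inj_eq[OF bij_is_inj[OF \<sigma>(2)], symmetric])
      (simp_all add: inv clinear_add[OF \<sigma>(3)] clinear_scale[OF \<sigma>(3)])
  from antipode obtain R1 R2 where
    R1: "\<And>a b c. (embed c \<otimes>\<^sub>M 1) \<rhd> R1 (a \<otimes> b) = tensor_lift (\<lambda>p q. p \<otimes> (S q \<rhd> b)) (T2 \<Delta> (c \<otimes> a))"
    and R2: "\<And>a b c. R2 (a \<otimes> b) \<lhd> (1 \<otimes>\<^sub>M embed c)
      = tensor_lift (\<lambda>p q. (a \<lhd> S p) \<otimes> q) (T1 \<Delta> (b \<otimes> c))"
    unfolding antipode_def by blast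
  show "(1 \<otimes>\<^sub>M embed b) * \<Delta> a \<in> range embed"
  proof -
    let ?U = "tensor_map id (inv \<sigma>)"
    note U = clinear_tensor_map[OF clinear_id(2) lin] tensor_map_pure[OF clinear_id(2) lin]
    let ?L = "\<lambda>p q. p \<otimes> (S q \<rhd> \<sigma> b)"
    have bil: "cbilinear ?L"
      by (rule cbilinearI)
        (simp_all add: \<sigma>(1) clinear_add[OF \<sigma>(3)] clinear_scale[OF \<sigma>(3)] pure_tensor_simps
          distrib_right scaleC_mult_left)
    have "?U (tensor_lift ?L t) = (1 \<otimes>\<^sub>M embed b) \<rhd> t" for t :: "'a \<otimes> 'a"
      by (rule fun_cong[OF clinear_tensor_ext[OF clinear_compose[OF clinear_tensor_lift[OF bil] U(1)]
            clinear_lact]])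
        (subst tensor_lift_pure[OF bil], simp add: U(2) \<sigma>(1) \<sigma>(4)[symmetric] inv)
    moreover have "?U ((embed c \<otimes>\<^sub>M 1) \<rhd> t) = (embed c \<otimes>\<^sub>M 1) \<rhd> ?U t" for c and t :: "'a \<otimes> 'a"
      by (rule fun_cong[OF clinear_tensor_ext[OF clinear_compose[OF clinear_lact U(1)]
            clinear_compose[OF U(1) clinear_lact]]])
        (simp add: U(2))
    ultimately have *: "(embed c \<otimes>\<^sub>M 1) \<rhd> ?U (R1 (a \<otimes> \<sigma> b)) = (1 \<otimes>\<^sub>M embed b) \<rhd> T2 \<Delta> (c \<otimes> a)" for c
      by (metis R1)
    have "embed (?U (R1 (a \<otimes> \<sigma> b))) = (1 \<otimes>\<^sub>M embed b) * \<Delta> a"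
    proof (rule multiplier_tensor_eqI(1))
      fix c
      have "(embed c \<otimes>\<^sub>M 1) * embed (?U (R1 (a \<otimes> \<sigma> b)))
          = (1 \<otimes>\<^sub>M embed b) * embed (T2 \<Delta> (c \<otimes> a))"
        by (simp only: mult_embed *)
      also have "\<dots> = (1 \<otimes>\<^sub>M embed b) * (embed c \<otimes>\<^sub>M 1) * \<Delta> a"
        by (simp only: embed_T2 mult.assoc)
      also have "\<dots> = (embed c \<otimes>\<^sub>M 1) * ((1 \<otimes>\<^sub>M embed b) * \<Delta> a)"
        by (simp only: mtensor_legs_commute mult.assoc)
      finally show "(embed c \<otimes>\<^sub>M 1) * embed (?U (R1 (a \<otimes> \<sigma> b)))
          = (embed c \<otimes>\<^sub>M 1) * ((1 \<otimes>\<^sub>M embed b) * \<Delta> a)" .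
    qed
    then show ?thesis by (metis rangeI)
  qed
  show "\<Delta> a * (embed b \<otimes>\<^sub>M 1) \<in> range embed"
  proof -
    let ?U = "tensor_map (inv \<sigma>) id"
    note U = clinear_tensor_map[OF lin clinear_id(2)] tensor_map_pure[OF lin clinear_id(2)]
    let ?L = "\<lambda>p q. (\<sigma> b \<lhd> S p) \<otimes> q"
    have bil: "cbilinear ?L"
      by (rule cbilinearI)
        (simp_all add: \<sigma>(1) clinear_add[OF \<sigma>(3)] clinear_scale[OF \<sigma>(3)] pure_tensor_simps
          distrib_left scaleC_mult_right)
    have "?U (tensor_lift ?L t) = t \<lhd> (embed b \<otimes>\<^sub>M 1)" for t :: "'a \<otimes> 'a"
      by (rule fun_cong[OF clinear_tensor_ext[OF clinear_compose[OF clinear_tensor_lift[OF bil] U(1)]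
            clinear_ract]])
        (subst tensor_lift_pure[OF bil], simp add: U(2) \<sigma>(1) \<sigma>(4)[symmetric] inv)
    moreover have "?U (t \<lhd> (1 \<otimes>\<^sub>M embed c)) = ?U t \<lhd> (1 \<otimes>\<^sub>M embed c)" for c and t :: "'a \<otimes> 'a"
      by (rule fun_cong[OF clinear_tensor_ext[OF clinear_compose[OF clinear_ract U(1)]
            clinear_compose[OF U(1) clinear_ract]]])
        (simp add: U(2))
    ultimately have *: "?U (R2 (\<sigma> b \<otimes> a)) \<lhd> (1 \<otimes>\<^sub>M embed c) = T1 \<Delta> (a \<otimes> c) \<lhd> (embed b \<otimes>\<^sub>M 1)" for c
      by (metis R2)
    have "embed (?U (R2 (\<sigma> b \<otimes> a))) = \<Delta> a * (embed b \<otimes>\<^sub>M 1)"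
    proof (rule multiplier_tensor_eqI(2))
      fix c
      have "embed (?U (R2 (\<sigma> b \<otimes> a))) * (1 \<otimes>\<^sub>M embed c)
          = embed (T1 \<Delta> (a \<otimes> c)) * (embed b \<otimes>\<^sub>M 1)"
        by (simp only: embed_mult *)
      also have "\<dots> = \<Delta> a * ((1 \<otimes>\<^sub>M embed c) * (embed b \<otimes>\<^sub>M 1))"
        by (simp only: embed_T1 mult.assoc)
      also have "\<dots> = \<Delta> a * (embed b \<otimes>\<^sub>M 1) * (1 \<otimes>\<^sub>M embed c)"
        by (simp only: mtensor_legs_commute mult.assoc)
      finally show "embed (?U (R2 (\<sigma> b \<otimes> a))) * (1 \<otimes>\<^sub>M embed c)
          = \<Delta> a * (embed b \<otimes>\<^sub>M 1) * (1 \<otimes>\<^sub>M embed c)" .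
    qed
    then show ?thesis by (metis rangeI)
  qed
qed

abbreviation cover_left :: "'a \<Rightarrow> 'a \<Rightarrow> 'a \<otimes> 'a"
  where "cover_left a b \<equiv> unembed (\<Delta> a * (embed b \<otimes>\<^sub>M 1))"

text \<open>Both sides are \<open>\<Delta>(a)(c \<otimes> b)\<close>.\<close>

lemma cover_left_T1: "cover_left a c \<lhd> (1 \<otimes>\<^sub>M embed b) = T1 \<Delta> (a \<otimes> b) \<lhd> (embed c \<otimes>\<^sub>M 1)"
  by (subst embed_tensor_inject[symmetric])
    (simp add: embed_mult[symmetric] embed_unembed_tensor[OF regular_cover(2)] embed_T1 mult.assoc
      mtensor_legs_commute)

lemma T1_mult: "T1 \<Delta> (a \<otimes> (b * c)) = T1 \<Delta> (a \<otimes> b) \<lhd> (1 \<otimes>\<^sub>M embed c)"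
  by (subst embed_tensor_inject[symmetric])
    (simp add: embed_mult[symmetric] embed_T1 mult.assoc mtensor_mult mult_embed)

text \<open>
  The counit property on the second leg is given for \<open>(c \<otimes> 1)\<Delta>(a)\<close>. Multiplying by \<open>c \<otimes> 1\<close> from
  the left and cancelling \<open>c\<close> transfers it to \<open>\<Delta>(a)(b \<otimes> 1)\<close>.
\<close>

lemma counit_cover_left: "slice_snd \<epsilon> (cover_left a b) = a * b"
proof -
  have "c * (slice_snd \<epsilon> (cover_left a b) - a * b) = 0" for c
  proof -
    have "(embed c \<otimes>\<^sub>M 1) \<rhd> cover_left a b = T2 \<Delta> (c \<otimes> a) \<lhd> (embed b \<otimes>\<^sub>M 1)"
      by (subst embed_tensor_inject[symmetric])
        (simp add: embed_mult[symmetric] mult_embed[symmetric]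
          embed_unembed_tensor[OF regular_cover(2)] embed_T2 mult.assoc)
    then have "c * slice_snd \<epsilon> (cover_left a b) = c * a * b"
      using slice_acts(3)[OF counit_linear, of "T2 \<Delta> (c \<otimes> a)" "embed b"]
        slice_acts(4)[OF counit_linear, of "embed c" "cover_left a b"]
      by (simp add: counit_snd)
    then show ?thesis by (simp add: right_diff_distrib mult.assoc)
  qed
  then show ?thesis using nondegenerate_right by (metis right_minus_eq)
qed

text \<open>
  A slice \<open>m\<close> satisfies \<open>(bm)c = b(mc)\<close>, so by non-degeneracy it vanishes as a right multiplier as
  soon as it vanishes as a left multiplier. The zero multiplier then meets the defining condition of
  the slice.
\<close>

lemma mslice_zeroI:
  assumes f: "clinear f"
  shows "(\<And>b. slice_fst f (T1 \<Delta> (a \<otimes> b)) = 0) \<Longrightarrow> mslice_fst f (\<Delta> a) = 0"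
    and "(\<And>b. slice_snd f (cover_left a b) = 0) \<Longrightarrow> mslice_snd f (\<Delta> a) = 0"
proof -
  have zero: "(0 :: 'a multiplier) \<rhd> b = 0" "b \<lhd> (0 :: 'a multiplier) = 0" for b
    by (transfer, simp)+
  show "mslice_fst f (\<Delta> a) = 0" if z: "\<And>b. slice_fst f (T1 \<Delta> (a \<otimes> b)) = 0"
  proof -
    have l: "unembed (\<Delta> a * (1 \<otimes>\<^sub>M embed b)) = T1 \<Delta> (a \<otimes> b)" for b
      by (simp add: embed_T1[symmetric])
    let ?R = "\<lambda>b. unembed ((1 \<otimes>\<^sub>M embed b) * \<Delta> a)"
    have "?R b \<lhd> (1 \<otimes>\<^sub>M embed c) = (1 \<otimes>\<^sub>M embed b) \<rhd> T1 \<Delta> (a \<otimes> c)" for b c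
      by (subst embed_tensor_inject[symmetric])
        (simp add: embed_mult[symmetric] mult_embed[symmetric]
          embed_unembed_tensor[OF regular_cover(1)] embed_T1 mult.assoc)
    then have "slice_fst f (?R b) * c = 0" for b c
      using slice_acts(1)[OF f, of "?R b" "embed c"]
        slice_acts(2)[OF f, of "embed b" "T1 \<Delta> (a \<otimes> c)"] z[of c] by simp
    then have r: "slice_fst f (?R b) = 0" for b by (rule nondegenerate_left)
    show ?thesis
      unfolding mslice_fst_def l z r
      by (rule the_equality) (auto simp: zero intro: multiplier_eqI)
  qed
  show "mslice_snd f (\<Delta> a) = 0" if z: "\<And>b. slice_snd f (cover_left a b) = 0"
  proof -
    let ?R = "\<lambda>b. unembed ((embed b \<otimes>\<^sub>M 1) * \<Delta> a)"
    have "?R b \<lhd> (embed c \<otimes>\<^sub>M 1) = (embed b \<otimes>\<^sub>M 1) \<rhd> cover_left a c" for b c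
      by (subst embed_tensor_inject[symmetric])
        (simp add: embed_mult[symmetric] mult_embed[symmetric]
          embed_unembed_tensor[OF regular_cover(2)] embed_unembed_tensor[OF coproduct_cover(2)]
          mult.assoc)
    then have "slice_snd f (?R b) * c = 0" for b c
      using slice_acts(3)[OF f, of "?R b" "embed c"]
        slice_acts(4)[OF f, of "embed b" "cover_left a c"] z[of c] by simp
    then have r: "slice_snd f (?R b) = 0" for b by (rule nondegenerate_left)
    show ?thesis
      unfolding mslice_snd_def z r
      by (rule the_equality) (auto simp: zero intro: multiplier_eqI)
  qed
qed

section \<open>The product of the dual\<close>

lemma left_integral_linear: "left_integral \<Delta> E \<phi> \<Longrightarrow> clinear \<phi>"
  by (simp add: left_integral_def)

lemma represents_linear:
  assumes "represents \<Delta> E xs \<omega>"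
  shows "\<And>\<phi> b. (\<phi>, b) \<in> set xs \<Longrightarrow> clinear \<phi>" "clinear \<omega>"
proof -
  show l: "\<And>\<phi> b. (\<phi>, b) \<in> set xs \<Longrightarrow> clinear \<phi>"
    using assms left_integral_linear by (auto simp: represents_def)
  have "\<omega> = (\<lambda>a. \<Sum>x\<leftarrow>xs. fst x (a * snd x))"
    using assms by (simp add: represents_def case_prod_unfold)
  moreover have "clinear (\<lambda>a. \<Sum>x\<leftarrow>xs. fst x (a * snd x))"
    by (rule clinear_sum_list_functional, rule clinear_mult_right_functional, use l in force)
  ultimately show "clinear \<omega>" by simp
qed

lemma represents_all_linear: "represents \<Delta> E xs \<omega> \<Longrightarrow> \<forall>(\<phi>, b) \<in> set xs. clinear \<phi>"
  using represents_linear(1) by blast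

lemma represents_slice_fst:
  "represents \<Delta> E xs \<omega> \<Longrightarrow>
    slice_fst \<omega> t = (\<Sum>(\<phi>, b)\<leftarrow>xs. slice_fst \<phi> (t \<lhd> (embed b \<otimes>\<^sub>M 1)))"
  using slice_sum_list_functional(1)[OF represents_all_linear] by (simp add: represents_def)

lemma represents_slice_snd:
  "represents \<Delta> E xs \<omega> \<Longrightarrow>
    slice_snd \<omega> t = (\<Sum>(\<phi>, b)\<leftarrow>xs. slice_snd \<phi> (t \<lhd> (1 \<otimes>\<^sub>M embed b)))"
  using slice_sum_list_functional(2)[OF represents_all_linear] by (simp add: represents_def)

lemma coproduct_act_pure:
  "\<Delta> a \<rhd> (b \<otimes> d) = T1 \<Delta> (a \<otimes> d) \<lhd> (embed b \<otimes>\<^sub>M 1)"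
  by (subst embed_tensor_inject[symmetric])
    (simp add: embed_mult[symmetric] mult_embed[symmetric] embed_T1 mult.assoc mtensor_mult
      embed_pure_tensor[symmetric])

lemma sum_list_swap:
  "(\<Sum>x\<leftarrow>xs. \<Sum>y\<leftarrow>ys. F x y) = (\<Sum>y\<leftarrow>ys. \<Sum>x\<leftarrow>xs. F x y :: complex)"
  by (induction xs) (simp_all add: sum_list_addf)

text \<open>
  For \<open>\<epsilon> = \<Sum> \<phi>\<^sub>i(\<cdot> b\<^sub>i)\<close> and \<open>\<omega> = \<Sum> \<psi>\<^sub>j(\<cdot> d\<^sub>j)\<close>, the summation over \<open>i\<close> turns
  \<open>\<Sum> (\<phi>\<^sub>i \<otimes> \<psi>\<^sub>j)(\<Delta>(a)(b\<^sub>i \<otimes> d\<^sub>j))\<close> into \<open>\<Sum> (\<epsilon> \<otimes> \<psi>\<^sub>j)(\<Delta>(a)(1 \<otimes> d\<^sub>j)) = \<Sum> \<psi>\<^sub>j(ad\<^sub>j)\<close>. The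
  outcome \<open>\<omega>(a)\<close> is the same for all representations, so it is the value of the product.
\<close>

lemma counit_is_unit:
  assumes \<epsilon>: "\<epsilon> \<in> dual \<Delta> E" and \<omega>: "\<omega> \<in> dual \<Delta> E"
  shows "dual_mult \<Delta> E \<epsilon> \<omega> = \<omega>" "dual_mult \<Delta> E \<omega> \<epsilon> = \<omega>"
proof -
  let ?sum = "\<lambda>xs ys a. \<Sum>(\<phi>, b)\<leftarrow>xs. \<Sum>(\<psi>, d)\<leftarrow>ys.
    tensor_lift (\<lambda>p q. \<phi> p * \<psi> q) (\<Delta> a \<rhd> (b \<otimes> d))"
  have left: "?sum xs ys a = \<omega> a" if xs: "represents \<Delta> E xs \<epsilon>" and ys: "represents \<Delta> E ys \<omega>" for xs ys a
  proof -
    have "?sum xs ys a = (\<Sum>(\<psi>, d)\<leftarrow>ys. \<Sum>(\<phi>, b)\<leftarrow>xs.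
        tensor_lift (\<lambda>p q. \<phi> p * \<psi> q) (\<Delta> a \<rhd> (b \<otimes> d)))"
      unfolding case_prod_unfold by (rule sum_list_swap)
    also have "\<dots> = (\<Sum>(\<psi>, d)\<leftarrow>ys. \<psi> (a * d))"
    proof (intro arg_cong[of _ _ sum_list] map_cong refl, clarify)
      fix \<psi> d assume "(\<psi>, d) \<in> set ys"
      then have \<psi>: "clinear \<psi>" by (rule represents_linear(1)[OF ys])
      have "(\<Sum>(\<phi>, b)\<leftarrow>xs. tensor_lift (\<lambda>p q. \<phi> p * \<psi> q) (\<Delta> a \<rhd> (b \<otimes> d)))
        = (\<Sum>(\<phi>, b)\<leftarrow>xs. \<psi> (slice_fst \<phi> (T1 \<Delta> (a \<otimes> d) \<lhd> (embed b \<otimes>\<^sub>M 1))))"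
        by (intro arg_cong[of _ _ sum_list] map_cong refl, clarify)
          (simp add: coproduct_act_pure tensor_lift_eq_slice_fst[OF represents_linear(1)[OF xs] \<psi>])
      also have "\<dots> = \<psi> (slice_fst \<epsilon> (T1 \<Delta> (a \<otimes> d)))"
        by (simp add: represents_slice_fst[OF xs] scale_sum_list_pair[OF \<psi>])
      finally show "(\<Sum>(\<phi>, b)\<leftarrow>xs. tensor_lift (\<lambda>p q. \<phi> p * \<psi> q) (\<Delta> a \<rhd> (b \<otimes> d))) = \<psi> (a * d)"
        by (simp add: counit_fst)
    qed
    finally show ?thesis using ys by (simp add: represents_def)
  qed
  have right: "?sum ys xs a = \<omega> a" if xs: "represents \<Delta> E xs \<epsilon>" and ys: "represents \<Delta> E ys \<omega>" for xs ys a
  proof -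
    have "?sum ys xs a = (\<Sum>(\<psi>, d)\<leftarrow>ys. \<psi> (a * d))"
    proof (intro arg_cong[of _ _ sum_list] map_cong refl, clarify)
      fix \<psi> d assume "(\<psi>, d) \<in> set ys"
      then have \<psi>: "clinear \<psi>" by (rule represents_linear(1)[OF ys])
      have "(\<Sum>(\<phi>, b)\<leftarrow>xs. tensor_lift (\<lambda>p q. \<psi> p * \<phi> q) (\<Delta> a \<rhd> (d \<otimes> b)))
        = (\<Sum>(\<phi>, b)\<leftarrow>xs. \<psi> (slice_snd \<phi> (cover_left a d \<lhd> (1 \<otimes>\<^sub>M embed b))))"
        by (intro arg_cong[of _ _ sum_list] map_cong refl, clarify)
          (simp add: coproduct_act_pure cover_left_T1
            tensor_lift_eq_slice_snd[OF \<psi> represents_linear(1)[OF xs]])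
      also have "\<dots> = \<psi> (slice_snd \<epsilon> (cover_left a d))"
        by (simp add: represents_slice_snd[OF xs] scale_sum_list_pair[OF \<psi>])
      finally show "(\<Sum>(\<phi>, b)\<leftarrow>xs. tensor_lift (\<lambda>p q. \<psi> p * \<phi> q) (\<Delta> a \<rhd> (d \<otimes> b))) = \<psi> (a * d)"
        by (simp add: counit_cover_left)
    qed
    then show ?thesis using ys by (simp add: represents_def)
  qed
  obtain xs ys where xs: "represents \<Delta> E xs \<epsilon>" and ys: "represents \<Delta> E ys \<omega>"
    using \<epsilon> \<omega> by (auto simp: dual_def)
  show "dual_mult \<Delta> E \<epsilon> \<omega> = \<omega>"
  proof (unfold dual_mult_def, rule ext, rule the_equality)
    fix a z
    show "\<forall>xs ys. represents \<Delta> E xs \<epsilon> \<and> represents \<Delta> E ys \<omega> \<longrightarrow> \<omega> a = ?sum xs ys a"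
      using left by simp
    assume "\<forall>xs ys. represents \<Delta> E xs \<epsilon> \<and> represents \<Delta> E ys \<omega> \<longrightarrow> z = ?sum xs ys a"
    then show "z = \<omega> a"
      using xs ys left by auto
  qed
  show "dual_mult \<Delta> E \<omega> \<epsilon> = \<omega>"
  proof (unfold dual_mult_def, rule ext, rule the_equality)
    fix a z
    show "\<forall>xs ys. represents \<Delta> E xs \<omega> \<and> represents \<Delta> E ys \<epsilon> \<longrightarrow> \<omega> a = ?sum xs ys a"
      using right by simp
    assume "\<forall>xs ys. represents \<Delta> E xs \<omega> \<and> represents \<Delta> E ys \<epsilon> \<longrightarrow> z = ?sum xs ys a"
    then show "z = \<omega> a"
      using xs ys right by auto
  qed
qed

end

section \<open>The counit as an element of the dual\<close>

context algebraic_quantum_groupoid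
begin

text \<open>
  A functional \<open>f\<close> that vanishes on the left-hand side satisfies
  \<open>\<phi>((f \<otimes> id)(\<Delta>(h)(1 \<otimes> b))) = 0\<close>. With \<open>bc\<close> in place of \<open>b\<close> this becomes
  \<open>\<phi>((f \<otimes> id)(\<Delta>(h)(1 \<otimes> b)) c) = 0\<close>, to which faithfulness of the integrals applies.
\<close>

lemma integral_slices_span:
  assumes h: "faithful_element \<Delta> h"
  shows "cvec.span {slice_snd \<phi> (T1 \<Delta> (h \<otimes> b)) | \<phi> b. left_integral \<Delta> E \<phi>} = UNIV"
proof (rule ccontr)
  let ?U = "{slice_snd \<phi> (T1 \<Delta> (h \<otimes> b)) | \<phi> b. left_integral \<Delta> E \<phi>}"
  assume "cvec.span ?U \<noteq> UNIV"
  then obtain x where "x \<notin> cvec.span ?U" by blast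
  then obtain f :: "'a \<Rightarrow> complex" where f: "clinear f" "\<And>u. u \<in> ?U \<Longrightarrow> f u = 0" "f x = 1"
    by (rule subspace_separation) blast
  have "slice_fst f (T1 \<Delta> (h \<otimes> b)) = 0" for b
  proof -
    have "\<phi> (slice_fst f (T1 \<Delta> (h \<otimes> b)) * c) = 0" if \<phi>: "left_integral \<Delta> E \<phi>" for \<phi> c
    proof -
      have "slice_fst f (T1 \<Delta> (h \<otimes> b)) * c = slice_fst f (T1 \<Delta> (h \<otimes> (b * c)))"
        by (simp add: T1_mult slice_acts(1)[OF f(1)])
      then show ?thesis
        using functional_slice_swap[OF f(1) left_integral_linear[OF \<phi>]] f(2) \<phi> by auto
    qed
    then show ?thesis using faithful_integrals unfolding faithful_integrals_def by blast
  qed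
  then have "mslice_fst f (\<Delta> h) = 0" by (rule mslice_zeroI(1)[OF f(1)])
  then have "f = (\<lambda>_. 0)" using h f(1) unfolding faithful_element_def by blast
  with f(3) show False by simp
qed

text \<open>A scalar in a linear combination is absorbed in \<open>b\<close>.\<close>

lemma integral_slice_representation:
  assumes "faithful_element \<Delta> h"
  shows "\<exists>xs. (\<forall>(\<phi>, b) \<in> set xs. left_integral \<Delta> E \<phi>) \<and> x = (\<Sum>(\<phi>, b)\<leftarrow>xs. slice_snd \<phi> (T1 \<Delta> (h \<otimes> b)))"
proof -
  have "x \<in> cvec.span {slice_snd \<phi> (T1 \<Delta> (h \<otimes> b)) | \<phi> b. left_integral \<Delta> E \<phi>}"
    using integral_slices_span[OF assms] by simp
  then show ?thesis
  proof (induction rule: cvec.span_induct_alt)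
    case base
    show ?case by (rule exI[of _ "[]"]) simp
  next
    case (step c u y)
    then obtain \<phi> b xs where \<phi>: "left_integral \<Delta> E \<phi>" "u = slice_snd \<phi> (T1 \<Delta> (h \<otimes> b))"
      and xs: "\<forall>(\<phi>, b) \<in> set xs. left_integral \<Delta> E \<phi>"
        "y = (\<Sum>(\<phi>, b)\<leftarrow>xs. slice_snd \<phi> (T1 \<Delta> (h \<otimes> b)))"
      by blast
    then show ?case
      by (intro exI[of _ "(\<phi>, c *\<^sub>C b) # xs"])
        (simp add: pure_tensor_simps clinear_scale[OF clinear_T1]
          clinear_scale[OF clinear_slice_snd[OF left_integral_linear[OF \<phi>(1)]]])
  qed
qed

text \<open>
  With \<open>h = \<Sum> (id \<otimes> \<phi>\<^sub>i)(\<Delta>(h)(1 \<otimes> b\<^sub>i))\<close> and \<open>\<omega> = \<Sum> \<phi>\<^sub>i(\<cdot> b\<^sub>i)\<close>, both \<open>\<omega>\<close> and \<open>\<epsilon>\<close> slice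
  \<open>\<Delta>(h)(c \<otimes> 1)\<close> to \<open>hc\<close>. Faithfulness of \<open>h\<close>, applied to \<open>\<omega> - \<epsilon>\<close>, gives \<open>\<omega> = \<epsilon>\<close>.
\<close>

lemma counit_in_dual:
  assumes h: "faithful_element \<Delta> h"
  shows "\<epsilon> \<in> dual \<Delta> E"
proof -
  obtain xs where xs: "\<forall>(\<phi>, b) \<in> set xs. left_integral \<Delta> E \<phi>"
    "h = (\<Sum>(\<phi>, b)\<leftarrow>xs. slice_snd \<phi> (T1 \<Delta> (h \<otimes> b)))"
    using integral_slice_representation[OF h, of h] by blast
  define \<omega> where "\<omega> = (\<lambda>a. \<Sum>(\<phi>, b)\<leftarrow>xs. \<phi> (a * b))"
  have rep: "represents \<Delta> E xs \<omega>"
    using xs(1) by (simp add: represents_def \<omega>_def)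
  note \<omega> = represents_linear(2)[OF rep]
  define f where "f = (\<lambda>a. \<omega> a + - 1 *\<^sub>C \<epsilon> a)"
  have neg: "clinear (\<lambda>a. - 1 *\<^sub>C \<epsilon> a)"
    by (rule cvec_pair.linear_compose_scale_right[OF counit_linear])
  have f: "clinear f"
    unfolding f_def by (rule cvec_pair.linear_compose_add[OF \<omega> neg])
  have "slice_snd f (cover_left h c) = 0" for c
  proof -
    have "slice_snd \<omega> (cover_left h c)
        = (\<Sum>(\<phi>, b)\<leftarrow>xs. slice_snd \<phi> (T1 \<Delta> (h \<otimes> b) \<lhd> (embed c \<otimes>\<^sub>M 1)))"
      by (simp add: represents_slice_snd[OF rep] cover_left_T1)
    also have "\<dots> = (\<Sum>(\<phi>, b)\<leftarrow>xs. slice_snd \<phi> (T1 \<Delta> (h \<otimes> b)) \<lhd> embed c)"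
      by (intro arg_cong[of _ _ sum_list] map_cong refl, clarify)
        (use xs(1) left_integral_linear slice_acts(3) in blast)
    also have "\<dots> = (\<Sum>(\<phi>, b)\<leftarrow>xs. slice_snd \<phi> (T1 \<Delta> (h \<otimes> b))) \<lhd> embed c"
      by (rule scale_sum_list_pair[OF clinear_ract, symmetric])
    also have "\<dots> = slice_snd \<epsilon> (cover_left h c)"
      unfolding xs(2)[symmetric] by (simp add: counit_cover_left)
    finally have eq: "slice_snd \<omega> (cover_left h c) = slice_snd \<epsilon> (cover_left h c)" .
    have "slice_snd (\<lambda>a. - 1 *\<^sub>C \<epsilon> a) t = - 1 *\<^sub>C slice_snd \<epsilon> t" for t
      by (rule fun_cong[OF clinear_tensor_ext[OF clinear_slice_snd[OF neg]
            cvec_pair.linear_compose_scale_right[OF clinear_slice_snd[OF counit_linear]]]])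
        (subst slice_snd_pure[OF neg], subst slice_snd_pure[OF counit_linear],
          simp only: scaleC_scaleC scaleC_complex_def)
    then show ?thesis
      unfolding f_def slice_functional_add(2)[OF \<omega> neg] eq by simp
  qed
  then have "mslice_snd f (\<Delta> h) = 0" by (rule mslice_zeroI(2)[OF f])
  then have "f = (\<lambda>_. 0)" using h f unfolding faithful_element_def by blast
  then have "\<omega> = \<epsilon>" by (simp add: f_def fun_eq_iff scaleC_complex_def)
  with rep show ?thesis by (auto simp: dual_def)
qed

end

theorem proposition4p24:
  fixes \<Delta> :: "'a::complex_algebra \<Rightarrow> ('a \<otimes> 'a) multiplier"
    and \<epsilon> :: "'a \<Rightarrow> complex"
    and E :: "('a \<otimes> 'a) multiplier"
    and G1 G2 :: "'a \<otimes> 'a \<Rightarrow> 'a \<otimes> 'a"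
    and S :: "'a \<Rightarrow> 'a multiplier"
    and h :: 'a
  assumes "algebraic_quantum_groupoid \<Delta> \<epsilon> E G1 G2 S"
    and "left_cointegral \<Delta> S (embed h)"
    and "faithful_element \<Delta> h"
  shows "compact_type (dual \<Delta> E) (dual_mult \<Delta> E)"
proof -
  interpret algebraic_quantum_groupoid \<Delta> \<epsilon> E G1 G2 S by (rule assms(1))
  have "\<epsilon> \<in> dual \<Delta> E" by (rule counit_in_dual[OF assms(3)])
  then show ?thesis
    unfolding compact_type_def using counit_is_unit by blast
qed

end
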